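(* For any fixed nonnegative integer $f$, every $n$-vertex unweighted undirected graph $G=(V,E)$ admits an $(f+1)$-fault-tolerant exact distance labeling scheme in which each vertex receives a label of $\widetilde{O}\left(n^{2-1/2^f}\right)$ bits.
   Context: An $(f+1)$-fault-tolerant exact distance labeling scheme for $G=(V,E)$ assigns a bitstring label $L(v)$ to each vertex $v\in V$ such that there is a decoding procedure which, for any vertices $s,t$ and any edge set $F\subseteq E$ with $|F|\le f+1$, computes $\mathrm{dist}_{G\setminus F}(s,t)$ using only $L(s)$, $L(t)$ and an explicit description of $F$ (no other information about $G$). $\widetilde{O}$ hides polylogarithmic factors in $n$. *)

theory Defs
  imports Complex_Main "HOL-Library.Extended_Nat" "HOL-Library.Landau_Symbols"
begin

definition simple_graph :: "'a set \<Rightarrow> 'a set set \<Rightarrow> bool" where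
  "simple_graph V E \<longleftrightarrow> finite V \<and> E \<subseteq> {e. e \<subseteq> V \<and> card e = 2}"

text \<open>A walk is the nonempty list of the vertices it visits, so \<open>[s]\<close> is the walk of length 0 at \<open>s\<close>.\<close>

definition walk_between :: "'a set set \<Rightarrow> 'a \<Rightarrow> 'a list \<Rightarrow> 'a \<Rightarrow> bool" where
  "walk_between E s p t \<longleftrightarrow>
     p \<noteq> [] \<and> hd p = s \<and> last p = t \<and> successively (\<lambda>u v. {u, v} \<in> E) p"

text \<open>The infimum of the empty set in \<^typ>\<open>enat\<close> is \<open>\<infinity>\<close>, the distance of disconnected vertices.\<close>

definition graph_dist :: "'a set set \<Rightarrow> 'a \<Rightarrow> 'a \<Rightarrow> enat" where
  "graph_dist E s t = (INF p\<in>{p. walk_between E s p t}. enat (length p - 1))"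

text \<open>
  The decoder is a parameter, and not existentially quantified for each graph, because it may use no
  information about the graph besides its arguments \<open>L s\<close>, \<open>L t\<close> and \<open>F\<close>: a
  decoder chosen after the graph could have all distances built in.
\<close>

definition ft_distance_labeling ::
  "nat \<Rightarrow> (bool list \<Rightarrow> bool list \<Rightarrow> 'a set set \<Rightarrow> enat)
     \<Rightarrow> 'a set \<Rightarrow> 'a set set \<Rightarrow> ('a \<Rightarrow> bool list) \<Rightarrow> bool" where
  "ft_distance_labeling r decode V E L \<longleftrightarrow>
     (\<forall>s\<in>V. \<forall>t\<in>V. \<forall>F. F \<subseteq> E \<and> finite F \<and> card F \<le> r \<longrightarrow>
        decode (L s) (L t) F = graph_dist (E - F) s t)"

definition soft_bigo :: "(nat \<Rightarrow> real) \<Rightarrow> (nat \<Rightarrow> real) set" where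
  "soft_bigo g = {h. \<exists>k::nat. h \<in> O(\<lambda>n. g n * ln (real n) ^ k)}"

end

theory Submission
  imports Defs "HOL-Library.Nat_Bijection" "HOL-Real_Asymp.Real_Asymp"
begin

text \<open>
  Perturb the edge lengths by tiny weights with \<open>\<omega>(u, v) = - \<omega>(v, u)\<close> so that shortest paths
  become unique in every subgraph. The label of \<open>s\<close> stores all edges of the selected shortest paths
  from \<open>s\<close> under at most \<open>f\<close> faults. Antisymmetry makes the selection restorable: for each fault
  \<open>e\<close>, some shortest path avoiding \<open>e\<close> is the concatenation of two selected paths of the graph that
  still contains \<open>e\<close>, one from \<open>s\<close> and one from \<open>t\<close>. Hence the two labels together survive one more
  fault than each of them was built for.

  For the size, fix \<open>v\<close> and count the last edges of the paths from a source set \<open>S\<close> to \<open>v\<close> under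
  at most \<open>j\<close> faults; the bound is \<open>O(n / y)\<close> where \<open>|S| y\<^sup>k \<le> n\<close> and \<open>k = 2\<^sup>j\<close>. Discover the
  faults one by one on the current shortest path, and record their distances from \<open>v\<close>. With
  thresholds \<open>D i\<close> of the order of \<open>y\<close> to the power \<open>2\<^sup>i\<close>, for \<open>i < j\<close>, either the recorded distances lie
  below the thresholds after sorting, and there are few such sequences, or for some \<open>i\<close> at most \<open>i\<close>
  faults lie within distance \<open>D i\<close>. In the second case these faults alone determine the final
  segment of length \<open>D i\<close>, and a set of \<open>O(n / D i)\<close> vertices meets half of these segments, so
  that induction applies with these vertices as sources and \<open>i\<close> faults.
\<close>

section \<open>Hitting sets and counting of position lists\<close>

text \<open>Take \<open>R\<close> maximizing the number of sets it hits minus a suitable multiple of its cardinality.\<close>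

lemma half_hitting_set:
  fixes X :: "'b \<Rightarrow> 'a set"
  assumes V: "finite V" and U: "finite U" and d: "1 \<le> d"
    and X: "\<And>u. u \<in> U \<Longrightarrow> X u \<subseteq> V \<and> d \<le> card (X u)"
  obtains R where "R \<subseteq> V" "card R * d \<le> 2 * card V" "card U \<le> 2 * card {u \<in> U. X u \<inter> R \<noteq> {}}"
proof (cases "U = {}")
  case True
  then show ?thesis using that[of "{}"] by simp
next
  case False
  define n q where "n = int (card V)" and "q = int (card U)"
  have q: "0 < q" using False U by (simp add: q_def card_gt_0_iff)
  obtain u where "u \<in> U" using False by blast
  hence n: "0 < n" using X[of u] d card_mono[OF V, of "X u"] by (simp add: n_def)
  define hit where "hit R = {u \<in> U. X u \<inter> R \<noteq> {}}" for R
  \<comment> \<open>The multiple is \<open>q * d / (2 * n)\<close>, with denominators cleared. At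
    the maximum no point \<open>x\<close> is worth adding, so \<open>x\<close> lies in at most
    \<open>q * d / (2 * n)\<close> of the sets not hit; comparison with the empty set bounds
    \<open>card R\<close>.\<close>
  define score where "score R = 2 * n * int (card (hit R)) - int (card R) * q * int d" for R
  have "Max (score ` Pow V) \<in> score ` Pow V" using V by (intro Max_in) auto
  then obtain R where R: "R \<subseteq> V" "score R = Max (score ` Pow V)" by auto
  have max: "score R' \<le> score R" if "R' \<subseteq> V" for R'
    unfolding R(2) using V that by (intro Max_ge) auto
  define N where "N = {u \<in> U. X u \<inter> R = {}}"
  have N: "finite N" using U by (simp add: N_def)
  have new: "2 * n * int (card {u \<in> N. x \<in> X u}) \<le> q * int d" if x: "x \<in> V" for x
  proof (cases "x \<in> R")
    case True
    hence "{u \<in> N. x \<in> X u} = {}" by (auto simp: N_def)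
    hence "card {u \<in> N. x \<in> X u} = 0" by (simp only: card.empty)
    thus ?thesis using q by simp
  next
    case False
    have "hit (insert x R) = hit R \<union> {u \<in> N. x \<in> X u}" by (auto simp: hit_def N_def)
    moreover have "hit R \<inter> {u \<in> N. x \<in> X u} = {}" by (auto simp: hit_def N_def)
    ultimately have "card (hit (insert x R)) = card (hit R) + card {u \<in> N. x \<in> X u}"
      using U N by (simp add: card_Un_disjoint hit_def)
    moreover have "card (insert x R) = Suc (card R)"
      using False R(1) V finite_subset by (metis card_insert_disjoint)
    ultimately show ?thesis using max[of "insert x R"] x R(1)
      by (simp add: score_def algebra_simps)
  qed
  \<comment> \<open>Double counting of the incidences between the sets not hit and the points of
    \<open>V\<close>: at least \<open>card N * d\<close> of them, and at most
    \<open>q * d / 2\<close> by \<open>new\<close>.\<close>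
  have "card N * d \<le> (\<Sum>u\<in>N. card (X u))"
    using sum_bounded_below[of N d "\<lambda>u. card (X u)"] X by (auto simp: N_def)
  also have "\<dots> = (\<Sum>u\<in>N. \<Sum>x\<in>V. if x \<in> X u then 1 else 0)"
  proof (rule sum.cong)
    fix u assume "u \<in> N"
    hence "X u = {x \<in> V. x \<in> X u}" using X by (auto simp: N_def)
    thus "card (X u) = (\<Sum>x\<in>V. if x \<in> X u then 1 else 0)"
      using V by (simp add: sum.If_cases Int_def)
  qed simp
  also have "\<dots> = (\<Sum>x\<in>V. card {u \<in> N. x \<in> X u})"
    using N by (subst sum.swap) (simp add: sum.If_cases Int_def)
  finally have "2 * n * (int (card N) * int d) \<le> 2 * n * (\<Sum>x\<in>V. int (card {u \<in> N. x \<in> X u}))"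
    using n by (intro mult_left_mono) (simp_all flip: of_nat_mult of_nat_sum)
  also have "\<dots> = (\<Sum>x\<in>V. 2 * n * int (card {u \<in> N. x \<in> X u}))"
    by (rule sum_distrib_left)
  also have "\<dots> \<le> n * (q * int d)"
    using sum_mono[OF new, of V "\<lambda>x. x"] by (simp add: n_def)
  finally have "2 * int (card N) \<le> q" using n d by simp
  moreover have "card U = card (hit R) + card N"
  proof -
    have "U = hit R \<union> N" "hit R \<inter> N = {}" by (auto simp: hit_def N_def)
    thus ?thesis using U by (metis card_Un_disjoint finite_Un)
  qed
  ultimately have hit: "card U \<le> 2 * card (hit R)" by (simp add: q_def)
  have "int (card R) * q * int d \<le> 2 * n * int (card (hit R))"
    using max[of "{}"] by (simp add: score_def hit_def)
  also have "\<dots> \<le> 2 * n * q"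
    using n U by (intro mult_left_mono) (auto simp: q_def hit_def intro: card_mono)
  finally have "int (card R) * int d \<le> 2 * n" using q by (simp add: mult.commute mult.left_commute)
  hence "card R * d \<le> 2 * card V" by (simp add: n_def flip: of_nat_mult)
  with that R(1) hit show ?thesis by (simp add: hit_def)
qed

text \<open>The lists of positive numbers that some permutation turns into a list below \<open>D 0, \<dots>, D (j - 1)\<close>.\<close>

definition dominated_lists :: "nat \<Rightarrow> (nat \<Rightarrow> nat) \<Rightarrow> nat list set" where
  "dominated_lists j D = {ls. length ls = j \<and> (\<forall>l\<in>set ls. 1 \<le> l) \<and>
     (\<forall>i<j. i < length (filter (\<lambda>l. l \<le> D i) ls))}"

text \<open>Some entry is at most \<open>D 0\<close>. Deleting it lowers each filtered count by at
  most one, so the rest is dominated by the shifted thresholds; the deleted entry is recovered from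
  its position (\<open>j + 1\<close> choices) and its value (\<open>D 0\<close> choices).\<close>

lemma finite_card_dominated_lists:
  "finite (dominated_lists j D) \<and> card (dominated_lists j D) \<le> fact j * (\<Prod>i<j. D i)"
proof (induction j arbitrary: D)
  case 0
  have "dominated_lists 0 D = {[]}" by (auto simp: dominated_lists_def)
  then show ?case by simp
next
  case (Suc j)
  let ?L = "dominated_lists j (D \<circ> Suc)"
  let ?f = "\<lambda>(k, l, ls). take k ls @ l # drop k ls"
  let ?I = "{..j} \<times> {1..D 0} \<times> ?L"
  have sub: "dominated_lists (Suc j) D \<subseteq> ?f ` ?I"
  proof
    fix ls assume ls: "ls \<in> dominated_lists (Suc j) D"
    hence "filter (\<lambda>l. l \<le> D 0) ls \<noteq> []" by (auto simp: dominated_lists_def)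
    then obtain l where "l \<in> set ls" "l \<le> D 0" by (auto simp: filter_empty_conv)
    then obtain xs ys where eq: "ls = xs @ l # ys" using split_list by metis
    have "i < length (filter (\<lambda>l. l \<le> (D \<circ> Suc) i) (xs @ ys))" if "i < j" for i
    proof -
      have "Suc i < length (filter (\<lambda>l. l \<le> D (Suc i)) ls)"
        using ls that unfolding dominated_lists_def by blast
      thus ?thesis unfolding eq by (simp split: if_splits)
    qed
    hence "xs @ ys \<in> ?L" using ls by (auto simp: dominated_lists_def eq)
    moreover have "length xs \<le> j" "1 \<le> l" using ls by (auto simp: dominated_lists_def eq)
    ultimately show "ls \<in> ?f ` ?I"
      using \<open>l \<le> D 0\<close> eq by (intro image_eqI[of _ _ "(length xs, l, xs @ ys)"]) auto
  qed
  have fin: "finite ?I" using Suc.IH by simp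
  have "card (dominated_lists (Suc j) D) \<le> card ?I"
    using surj_card_le[OF fin sub] .
  also have "\<dots> = Suc j * (D 0 * card ?L)" by (simp add: card_cartesian_product)
  also have "\<dots> \<le> Suc j * (D 0 * (fact j * (\<Prod>i<j. (D \<circ> Suc) i)))"
    by (intro mult_left_mono conjunct2[OF Suc.IH]) auto
  also have "\<dots> = fact (Suc j) * (\<Prod>i<Suc j. D i)"
    by (subst prod.lessThan_Suc_shift) (simp add: algebra_simps)
  finally show ?case using finite_subset[OF sub] fin by blast
qed

section \<open>Walks, weights and shortest paths\<close>

fun path_edges :: "'a list \<Rightarrow> 'a set set" where
  "path_edges (x # y # p) = insert {x, y} (path_edges (y # p))"
| "path_edges _ = {}"

fun path_weight :: "('a \<Rightarrow> 'a \<Rightarrow> 'b::comm_monoid_add) \<Rightarrow> 'a list \<Rightarrow> 'b" where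
  "path_weight w (x # y # p) = w x y + path_weight w (y # p)"
| "path_weight w _ = 0"

lemma path_edges_append: "path_edges (p @ x # q) = path_edges (p @ [x]) \<union> path_edges (x # q)"
  by (induction p rule: path_edges.induct) auto

lemma path_weight_append:
  "path_weight w (p @ x # q) = path_weight w (p @ [x]) + path_weight w (x # q)"
  by (induction w p rule: path_weight.induct) (auto simp: add.assoc)

lemma path_edges_rev: "path_edges (rev p) = path_edges p"
proof (induction p rule: path_edges.induct)
  case (1 x y p)
  have "path_edges (rev (x # y # p)) = path_edges (rev p @ y # [x])" by simp
  also have "\<dots> = path_edges (rev p @ [y]) \<union> path_edges [y, x]" by (rule path_edges_append)
  finally show ?case using 1 by (auto simp: insert_commute)
qed auto

lemma successively_iff_path_edges:
  "successively (\<lambda>u v. {u, v} \<in> A) p \<longleftrightarrow> path_edges p \<subseteq> A"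
  by (induction p rule: path_edges.induct) auto

lemma walk_between_iff:
  "walk_between A s p t \<longleftrightarrow> p \<noteq> [] \<and> hd p = s \<and> last p = t \<and> path_edges p \<subseteq> A"
  by (simp add: walk_between_def successively_iff_path_edges)

lemma walk_between_mono: "walk_between A s p t \<Longrightarrow> A \<subseteq> B \<Longrightarrow> walk_between B s p t"
  by (auto simp: walk_between_iff)

lemma walk_between_join:
  assumes "walk_between A s (p @ [x]) x" "walk_between A x (x # q) t"
  shows "walk_between A s (p @ x # q) t"
  using assms path_edges_append[of p x q] by (cases p) (auto simp: walk_between_iff)

lemma walk_between_rev: "walk_between A s p t \<Longrightarrow> walk_between A t (rev p) s"
  by (auto simp: walk_between_iff path_edges_rev hd_rev last_rev)

lemma walk_between_split:
  assumes "walk_between A s (p @ x # q) t"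
  shows "walk_between A s (p @ [x]) x" "walk_between A x (x # q) t"
  using assms path_edges_append[of p x q] by (cases p; auto simp: walk_between_iff)+

lemma walk_between_shortcut:
  assumes "walk_between A s p t" "\<not> distinct p"
  obtains xs y ys zs where "p = xs @ y # (ys @ y # zs)" "walk_between A s (xs @ y # zs) t"
proof -
  obtain xs ys zs y where p: "p = xs @ [y] @ ys @ [y] @ zs"
    using not_distinct_decomp assms(2) by blast
  have "walk_between A s (xs @ y # (ys @ y # zs)) t"
    using assms(1) p by simp
  note 1 = walk_between_split[OF this]
  have "walk_between A y ((y # ys) @ y # zs) t" using 1 by simp
  note 2 = walk_between_split[OF this]
  have "walk_between A s (xs @ y # zs) t" using walk_between_join 1 2 by metis
  with p show ?thesis using that by simp
qed

lemma walk_between_concat: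
  assumes "walk_between A s p x" "walk_between A x q t"
  shows "walk_between A s (p @ tl q) t"
proof -
  obtain p' where p: "p = p' @ [x]" using assms(1)
    by (metis append_butlast_last_id walk_between_iff)
  obtain q' where q: "q = x # q'" using assms(2)
    by (metis list.collapse walk_between_iff)
  show ?thesis using walk_between_join[of A s p' x q' t] assms p q by simp
qed

lemma path_edges_split:
  assumes "e \<in> path_edges p"
  obtains ps a b qs where "p = ps @ a # b # qs" "e = {a, b}"
proof -
  have "\<exists>ps a b qs. p = ps @ a # b # qs \<and> e = {a, b}"
    using assms
  proof (induction p rule: path_edges.induct)
    case (1 x y p)
    show ?case
    proof (cases "e = {x, y}")
      case True
      then show ?thesis by (metis append_Nil)
    next
      case False
      then obtain ps a b qs where "y # p = ps @ a # b # qs" "e = {a, b}" using 1 by auto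
      then show ?thesis by (metis append_Cons)
    qed
  qed auto
  then show ?thesis using that by blast
qed

lemma path_edges_subset_set: "e \<in> path_edges p \<Longrightarrow> e \<subseteq> set p"
  by (induction p rule: path_edges.induct) auto

lemma set_subset_path_edges:
  "2 \<le> length p \<Longrightarrow> set p \<subseteq> \<Union> (path_edges p)"
proof (induction p rule: path_edges.induct)
  case (1 x y p)
  then show ?case by (cases p) auto
qed auto

section \<open>Distances as lengths of shortest walks\<close>

lemma graph_dist_le: "walk_between A s p t \<Longrightarrow> graph_dist A s t \<le> enat (length p - 1)"
  unfolding graph_dist_def by (rule INF_lower) simp

lemma graph_dist_eqI:
  assumes "walk_between A s p t" "\<And>q. walk_between A s q t \<Longrightarrow> length p \<le> length q"
  shows "graph_dist A s t = enat (length p - 1)"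
  unfolding graph_dist_def
proof (rule antisym)
  show "(INF p\<in>{p. walk_between A s p t}. enat (length p - 1)) \<le> enat (length p - 1)"
    using assms(1) by (intro INF_lower) simp
  show "enat (length p - 1) \<le> (INF p\<in>{p. walk_between A s p t}. enat (length p - 1))"
    using assms(2) by (intro INF_greatest) (auto intro: diff_le_mono)
qed

lemma graph_dist_infinity:
  assumes "\<And>p. \<not> walk_between A s p t"
  shows "graph_dist A s t = \<infinity>"
  using assms by (simp add: graph_dist_def top_enat_def)

lemma graph_dist_antimono: "A \<subseteq> B \<Longrightarrow> graph_dist B s t \<le> graph_dist A s t"
  unfolding graph_dist_def by (rule INF_superset_mono) (auto intro: walk_between_mono)

text \<open>The perturbed lengths are scaled to natural numbers: \<open>M\<close> stands for the
  unit length and \<open>w u v - M\<close> for the antisymmetric perturbation, which explains the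
  sum \<open>2 * M\<close>. In \<open>weight_inj\<close> only the starting points must agree, so a
  weight determines the other endpoint too.\<close>

locale tiebreaking =
  fixes V :: "'a set" and E :: "'a set set" and w :: "'a \<Rightarrow> 'a \<Rightarrow> nat" and M :: nat
  assumes graph: "simple_graph V E"
    and weight_pos: "{u, v} \<in> E \<Longrightarrow> 0 < w u v"
    and weight_antisym: "{u, v} \<in> E \<Longrightarrow> w u v + w v u = 2 * M"
    and weight_length: "p \<noteq> [] \<Longrightarrow> distinct p \<Longrightarrow> path_edges p \<subseteq> E \<Longrightarrow> path_edges q \<subseteq> E \<Longrightarrow>
      length p < length q \<Longrightarrow> path_weight w p < path_weight w q"
    and weight_inj: "distinct p \<Longrightarrow> distinct q \<Longrightarrow> path_edges p \<subseteq> E \<Longrightarrow> path_edges q \<subseteq> E \<Longrightarrow>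
      p \<noteq> [] \<Longrightarrow> q \<noteq> [] \<Longrightarrow> hd p = hd q \<Longrightarrow> path_weight w p = path_weight w q \<Longrightarrow> p = q"
begin

lemma finite_V: "finite V" and edge_subset: "e \<in> E \<Longrightarrow> e \<subseteq> V" and edge_card: "e \<in> E \<Longrightarrow> card e = 2"
  using graph by (auto simp: simple_graph_def)

section \<open>Unique shortest paths and their restoration after one more fault\<close>

definition sp :: "'a set set \<Rightarrow> 'a \<Rightarrow> 'a list \<Rightarrow> 'a \<Rightarrow> bool" where
  "sp A s p t \<longleftrightarrow> A \<subseteq> E \<and> walk_between A s p t \<and>
     (\<forall>q. walk_between A s q t \<longrightarrow> path_weight w p \<le> path_weight w q)"

lemma sp_walk: "sp A s p t \<Longrightarrow> walk_between A s p t"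
  by (simp add: sp_def)

lemma sp_exists:
  assumes "A \<subseteq> E" "walk_between A s q t"
  obtains p where "sp A s p t"
  using assms ex_has_least_nat[of "\<lambda>q. walk_between A s q t" q "path_weight w"]
  unfolding sp_def by blast

lemma path_weight_pos: "path_edges p \<subseteq> E \<Longrightarrow> 2 \<le> length p \<Longrightarrow> 0 < path_weight w p"
  by (induction p rule: path_edges.induct) (auto simp: weight_pos)

text \<open>Cutting out a closed subwalk saves its positive weight.\<close>

lemma sp_distinct:
  assumes "sp A s p t"
  shows "distinct p"
proof (rule ccontr)
  assume "\<not> distinct p"
  then obtain xs y ys zs where p: "p = xs @ y # (ys @ y # zs)"
    and short: "walk_between A s (xs @ y # zs) t"
    using walk_between_shortcut sp_walk[OF assms] by metis
  have "path_weight w p \<le> path_weight w (xs @ y # zs)" using short assms sp_def by blast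
  moreover have "path_weight w p = path_weight w (xs @ [y]) + path_weight w ((y # ys) @ [y])
      + path_weight w (y # zs)"
    using path_weight_append[of w xs y "ys @ y # zs"] path_weight_append[of w "y # ys" y zs] p by simp
  moreover have "path_weight w (xs @ y # zs) = path_weight w (xs @ [y]) + path_weight w (y # zs)"
    by (rule path_weight_append)
  moreover have "0 < path_weight w ((y # ys) @ [y])"
    using assms p path_edges_append[of xs y "ys @ y # zs"] path_edges_append[of "y # ys" y zs]
    by (intro path_weight_pos) (auto simp: walk_between_iff sp_def)
  ultimately show False by simp
qed

lemma sp_subset: "sp A s p t \<Longrightarrow> path_edges p \<subseteq> E"
  by (auto simp: sp_def walk_between_iff)

lemma sp_unique:
  assumes "sp A s p t" "sp A s q t"
  shows "p = q"
proof (rule weight_inj)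
  show "path_weight w p = path_weight w q"
    using assms by (meson antisym sp_def)
qed (use assms sp_distinct sp_subset in \<open>auto dest!: sp_walk simp: walk_between_iff\<close>)

text \<open>\<open>weight_length\<close> asks for a repetition-free shorter walk. The comparison is
  therefore made with a walk of least length, which has no repeated vertex because it could be
  shortcut otherwise.\<close>

lemma sp_length_le:
  assumes "sp A s p t" "walk_between A s q t"
  shows "length p \<le> length q"
proof (rule ccontr)
  assume "\<not> length p \<le> length q"
  obtain q' where q': "walk_between A s q' t" "\<And>q. walk_between A s q t \<Longrightarrow> length q' \<le> length q"
    using ex_has_least_nat[of "\<lambda>q. walk_between A s q t" q length] assms(2) by blast
  have "distinct q'"
  proof (rule ccontr)
    assume "\<not> distinct q'"
    then obtain xs y ys zs where q: "q' = xs @ y # (ys @ y # zs)"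
      and short: "walk_between A s (xs @ y # zs) t"
      using walk_between_shortcut q'(1) by metis
    from q'(2)[OF short] q show False by simp
  qed
  moreover have "length q' < length p" using q'(2)[OF assms(2)] \<open>\<not> _\<close> by simp
  ultimately have "path_weight w q' < path_weight w p"
    using q'(1) assms(1) by (intro weight_length) (auto simp: sp_def walk_between_iff)
  with assms(1) q'(1) show False by (auto simp: sp_def not_less)
qed

lemma sp_graph_dist: "sp A s p t \<Longrightarrow> graph_dist A s t = enat (length p - 1)"
  by (blast intro: graph_dist_eqI sp_walk sp_length_le)

lemma sp_split:
  assumes "sp A s (p @ x # q) t"
  shows sp_prefix: "sp A s (p @ [x]) x" and sp_suffix: "sp A x (x # q) t"
proof -
  note wb = walk_between_split[OF sp_walk[OF assms]]
  have A: "A \<subseteq> E" using assms by (simp add: sp_def)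
  have min: "path_weight w (p @ [x]) + path_weight w (x # q) \<le> path_weight w r"
    if "walk_between A s r t" for r
    using assms that path_weight_append[of w p x q] by (simp add: sp_def)
  have "path_weight w (p @ [x]) \<le> path_weight w r" if r: "walk_between A s r x" for r
  proof -
    obtain r' where r': "r = r' @ [x]" using r
      by (metis append_butlast_last_id walk_between_iff)
    have "walk_between A s (r' @ x # q) t" using walk_between_join r r' wb by metis
    from min[OF this] show ?thesis by (simp add: path_weight_append[of w r' x q] r')
  qed
  then show "sp A s (p @ [x]) x" using wb A by (simp add: sp_def)
  have "path_weight w (x # q) \<le> path_weight w r" if r: "walk_between A x r t" for r
  proof -
    obtain r' where r': "r = x # r'" using r by (metis list.collapse walk_between_iff)
    have "walk_between A s (p @ x # r') t" using walk_between_join r r' wb by metis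
    from min[OF this] show ?thesis by (simp add: path_weight_append[of w p x r'] r')
  qed
  then show "sp A x (x # q) t" using wb A by (simp add: sp_def)
qed

lemma sp_subgraph: "sp A s p t \<Longrightarrow> B \<subseteq> A \<Longrightarrow> walk_between B s p t \<Longrightarrow> sp B s p t"
  unfolding sp_def using walk_between_mono by (metis order_trans)

lemma sp_strict:
  assumes "sp A s p t" "walk_between A s q t" "p \<noteq> q"
  shows "path_weight w p < path_weight w q"
proof (rule ccontr)
  assume "\<not> ?thesis"
  hence "sp A s q t" using assms(1,2) by (fastforce simp: sp_def)
  thus False using sp_unique assms by blast
qed

text \<open>
  Let \<open>x\<close> be the last vertex of a shortest path avoiding \<open>e\<close> that the tie-breaking path from
  \<open>s\<close> reaches without \<open>e\<close>, and let \<open>y\<close> be its successor. If both the path from \<open>s\<close> to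
  \<open>y\<close> and the path from \<open>t\<close> to \<open>x\<close> use \<open>e\<close>, then either they traverse it in the same direction,
  and shortcutting contradicts minimality, or in opposite directions, and adding up the two
  optimality inequalities contradicts antisymmetry of the weights.
\<close>

lemma restoration:
  assumes A: "A \<subseteq> E" and P: "walk_between (A - {e}) s P t"
    and min: "\<And>q. walk_between (A - {e}) s q t \<Longrightarrow> length P \<le> length q"
  obtains x p q where "sp A s p x" "sp A t q x" "e \<notin> path_edges p" "e \<notin> path_edges q"
    "length p + length q = length P + 1"
proof -
  have P_ne: "P \<noteq> []" and P_hd: "hd P = s"
    and P_edges: "path_edges P \<subseteq> A - {e}"
    using P by (auto simp: walk_between_iff)
  define good where "good i \<longleftrightarrow> (\<exists>p. sp A s p (P ! i) \<and> e \<notin> path_edges p)" for i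
  have "sp A s [s] s" using A by (auto simp: sp_def walk_between_iff)
  hence good0: "good 0" using P_hd P_ne by (auto simp: good_def hd_conv_nth)
  define i where "i = (GREATEST i. i < length P \<and> good i)"
  have i: "i < length P \<and> good i" unfolding i_def
    by (rule GreatestI_nat[where b = "length P" and k = 0]) (use good0 P_ne in auto)
  have i_max: "j \<le> i" if "j < length P" "good j" for j
    unfolding i_def by (rule Greatest_le_nat[where b = "length P"]) (use that in auto)
  define x where "x = P ! i"
  obtain P1 P2 where P_split: "P = P1 @ x # P2" and P1: "length P1 = i"
    using i x_def by (metis id_take_nth_drop length_take min.absorb4)
  obtain p where p: "sp A s p x" "e \<notin> path_edges p"
    using i by (auto simp: good_def x_def)
  note Pw = walk_between_split[OF P[unfolded P_split]]
  have p_wb: "walk_between (A - {e}) s p x"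
    using p by (auto simp: sp_def walk_between_iff)
  \<comment> \<open>Upper bound: the prefix of \<open>P\<close> ending at \<open>x\<close> competes
    with \<open>p\<close> in \<open>A\<close>. Lower bound: \<open>p\<close> avoids
    \<open>e\<close>, so it may replace that prefix in the minimal walk \<open>P\<close>.\<close>
  have p_len: "length p = i + 1"
  proof (rule antisym)
    have "walk_between A s (P1 @ [x]) x" by (rule walk_between_mono[OF Pw(1)]) blast
    from sp_length_le[OF p(1) this] show "length p \<le> i + 1" using P1 by simp
    have "length P \<le> length (p @ tl (x # P2))"
      by (intro min walk_between_concat[OF p_wb Pw(2)])
    thus "i + 1 \<le> length p" using P_split P1 by simp
  qed
  have tx: "walk_between (A - {e}) t (rev (x # P2)) x"
    using walk_between_rev[OF Pw(2)] .
  then obtain q where q: "sp A t q x"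
    using sp_exists[OF A] walk_between_mono[of "A - {e}" _ _ _ A] by blast
  have q_len: "length q \<le> length P - i"
    using sp_length_le[OF q walk_between_mono[OF tx]] P_split P1 by auto
  have q_avoids: "e \<notin> path_edges q"
  proof
    assume eq: "e \<in> path_edges q"
    \<comment> \<open>A path using \<open>e\<close> has at least one edge, so \<open>x\<close> is
      not the end of \<open>P\<close> and has a successor \<open>y\<close>.\<close>
    have Suc_i: "Suc i < length P"
    proof (rule ccontr)
      assume "\<not> Suc i < length P"
      hence "length q \<le> 1" using q_len i by linarith
      with eq show False by (cases q rule: path_edges.cases) auto
    qed
    then obtain y P3 where P2: "P2 = y # P3"
      using P_split P1 by (cases P2) auto
    have y: "y = P ! Suc i" using P_split P1 P2 by (simp add: nth_append)
    have xy: "{x, y} \<in> A" "{x, y} \<noteq> e"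
      using P_edges path_edges_append[of P1 x P2] unfolding P_split P2 by auto
    have "walk_between (A - {e}) s ((P1 @ [x]) @ y # P3) t"
      using P P_split P2 by simp
    note Py = walk_between_split[OF this]
    obtain r where r: "sp A s r y"
      using sp_exists[OF A] Py(1) walk_between_mono[of "A - {e}" _ _ _ A] by blast
    have r_len: "length r \<le> i + 2"
      using sp_length_le[OF r walk_between_mono[OF Py(1)]] P1 by auto
    have "\<not> good (Suc i)" using i_max[of "Suc i"] Suc_i by auto
    hence er: "e \<in> path_edges r" using r by (auto simp: good_def y)
    obtain r1 u v r2 where r_eq: "r = r1 @ u # v # r2" and e: "e = {u, v}"
      using path_edges_split[OF er] .
    obtain q1 a b q2 where q_eq: "q = q1 @ a # b # q2" and e': "e = {a, b}"
      using path_edges_split[OF eq] .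
    note r_dist = sp_distinct[OF r, unfolded r_eq] and q_dist = sp_distinct[OF q, unfolded q_eq]
    \<comment> \<open>A path visits each endpoint of \<open>e\<close> once, so the pieces before and
      after the traversal of \<open>e\<close> do not contain \<open>e\<close>.\<close>
    have avoid: "e \<notin> path_edges (r1 @ [u])" "e \<notin> path_edges (v # r2)"
      "e \<notin> path_edges (q1 @ [a])" "e \<notin> path_edges (b # q2)"
      using r_dist q_dist e e' path_edges_subset_set[of e] by fastforce+
    have r_pre: "sp A s (r1 @ [u]) u" and r_suf: "sp A u (u # v # r2) y"
      using sp_split r unfolding r_eq by blast+
    have q_pre: "sp A t (q1 @ [a]) a" and q_suf: "sp A a (a # b # q2) x"
      using sp_split q unfolding q_eq by blast+
    have v_suf: "walk_between A v (v # r2) y" and b_suf: "walk_between A b (b # q2) x"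
      using r_suf q_suf by (auto simp: sp_def walk_between_iff)
    consider "a = u" "b = v" | "a = v" "b = u" using e e' by (auto simp: doubleton_eq_iff)
    then show False
    proof cases
      \<comment> \<open>Same direction: follow \<open>r\<close> to \<open>u\<close>, then
        \<open>q\<close> backwards to \<open>t\<close>, leaving out both traversals of
        \<open>e\<close>. Since \<open>length r1 \<le> i\<close> and
        \<open>length q1 \<le> length P - i - 2\<close>, this walk is shorter than
        \<open>P\<close>.\<close>
      case 1
      have "walk_between (A - {e}) s (r1 @ [u]) u"
        using r_pre avoid by (auto simp: sp_def walk_between_iff)
      moreover have "walk_between (A - {e}) u (rev (q1 @ [u])) t"
        using q_pre avoid 1 by (intro walk_between_rev) (auto simp: sp_def walk_between_iff)
      ultimately have "walk_between (A - {e}) s ((r1 @ [u]) @ tl (rev (q1 @ [u]))) t"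
        by (rule walk_between_concat)
      from min[OF this] have "length P \<le> length r1 + 1 + length q1" by simp
      with r_len q_len r_eq q_eq Suc_i show False by simp
    next
      \<comment> \<open>Opposite directions: from \<open>u\<close>, the walk along \<open>q2\<close>
        to \<open>x\<close> and on to \<open>y\<close> competes with the end of \<open>r\<close>,
        strictly because it avoids \<open>e\<close>; from \<open>v\<close>, the walk along
        \<open>r2\<close> to \<open>y\<close> and on to \<open>x\<close> competes with the end of
        \<open>q\<close>. Adding both gives \<open>w u v + w v u < w x y + w y x\<close>, but both
        sides equal \<open>2 * M\<close>.\<close>
      case 2
      have "walk_between A u ((u # q2) @ tl [x, y]) y"
        using b_suf 2 xy by (intro walk_between_concat[where x = x]) (auto simp: walk_between_iff)
      moreover have "u # v # r2 \<noteq> (u # q2) @ tl [x, y]"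
      proof
        assume *: "u # v # r2 = (u # q2) @ tl [x, y]"
        have "e \<notin> path_edges ((u # q2) @ [y])"
        proof -
          obtain q3 where q3: "u # q2 = q3 @ [x]"
            using b_suf 2 by (metis append_butlast_last_id walk_between_iff)
          have "path_edges ((u # q2) @ [y]) = path_edges (q3 @ [x]) \<union> path_edges [x, y]"
            using path_edges_append[of q3 x "[y]"] q3 by simp
          thus ?thesis using avoid(4) 2 q3 xy by auto
        qed
        moreover have "e \<in> path_edges (u # v # r2)" using e by simp
        ultimately show False unfolding * by simp
      qed
      ultimately have "path_weight w (u # v # r2) < path_weight w ((u # q2) @ tl [x, y])"
        using sp_strict[OF r_suf] by blast
      also have "\<dots> = path_weight w (u # q2) + w x y"
      proof -
        obtain q3 where q3: "u # q2 = q3 @ [x]"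
          using b_suf 2 by (metis append_butlast_last_id walk_between_iff)
        show ?thesis using path_weight_append[of w q3 x "[y]"] q3 by simp
      qed
      finally have lt: "w u v + path_weight w (v # r2) < path_weight w (u # q2) + w x y" by simp
      have "walk_between A v ((v # r2) @ tl [y, x]) x"
        using v_suf xy by (intro walk_between_concat[where x = y])
          (auto simp: walk_between_iff insert_commute)
      hence "path_weight w (v # u # q2) \<le> path_weight w ((v # r2) @ tl [y, x])"
        using q_suf 2 by (simp add: sp_def)
      also have "\<dots> = path_weight w (v # r2) + w y x"
      proof -
        obtain r3 where r3: "v # r2 = r3 @ [y]"
          using v_suf by (metis append_butlast_last_id walk_between_iff)
        show ?thesis using path_weight_append[of w r3 y "[x]"] r3 by simp
      qed
      finally have le: "w v u + path_weight w (u # q2) \<le> path_weight w (v # r2) + w y x" by simp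
      have "{u, v} \<in> E" using sp_subset[OF r_suf] by simp
      hence "w u v + w v u = 2 * M" "w x y + w y x = 2 * M"
        using weight_antisym xy A by blast+
      with lt le show False by linarith
    qed
  qed
  have "walk_between (A - {e}) x (rev q) t"
    using q q_avoids by (intro walk_between_rev) (auto simp: sp_def walk_between_iff)
  \<comment> \<open>Joining \<open>p\<close> with the reverse of \<open>q\<close> gives a walk
    avoiding \<open>e\<close>, so minimality of \<open>P\<close> supplies the missing inequality;
    the 1 arises because both lists contain \<open>x\<close>.\<close>
  from min[OF walk_between_concat[OF p_wb this]]
  have "length P \<le> length p + (length q - 1)" by simp
  moreover have "q \<noteq> []" using q by (auto simp: sp_def walk_between_iff)
  ultimately have "length p + length q = length P + 1"
    using q_len p_len i by (cases q) auto
  with that p q q_avoids show ?thesis by blast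
qed


end

section \<open>Counting last edges\<close>

definition last_edges_const :: "nat \<Rightarrow> real" where
  "last_edges_const j = 6 ^ j * (fact j * 2 ^ j + 1)"

lemma last_edges_const_ge_1: "1 \<le> last_edges_const j"
  unfolding last_edges_const_def
  by (rule mult_ge1_I) (simp_all add: one_le_power)

text \<open>The recurrence behind \<open>card_last_edges\<close>: \<open>fact j * 2 ^ j\<close> pays
  for the dominated fault sequences, and each \<open>i < j\<close> costs 1 for short paths plus 4
  for long ones. The powers of 6 make the sum geometric, with value
  \<open>6 ^ j - 1\<close>.\<close>

lemma last_edges_const_rec:
  "fact j * 2 ^ j + (\<Sum>i<j. 5 * last_edges_const i) \<le> last_edges_const j"
proof -
  let ?K = "\<lambda>j. fact j * 2 ^ j + 1 :: real"
  have "(\<Sum>i<j. 5 * last_edges_const i) \<le> (\<Sum>i<j. 5 * (6 ^ i * ?K j))"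
    unfolding last_edges_const_def
    by (intro sum_mono mult_left_mono add_mono mult_mono fact_mono power_increasing) auto
  also have "\<dots> = (\<Sum>i<j. 5 * 6 ^ i) * ?K j" by (simp add: sum_distrib_right mult.assoc)
  also have "(\<Sum>i<j. 5 * 6 ^ i) = (6 ^ j - 1 :: real)" by (induction j) auto
  finally show ?thesis by (simp add: last_edges_const_def algebra_simps)
qed

context tiebreaking
begin

text \<open>With \<open>v\<close> fixed, an edge into \<open>v\<close> is represented by its other
  endpoint.\<close>

definition last_edges :: "nat \<Rightarrow> 'a set \<Rightarrow> 'a \<Rightarrow> 'a set" where
  "last_edges j S v = {u. \<exists>s\<in>S. \<exists>F p. finite F \<and> card F \<le> j \<and> sp (E - F) s (p @ [u, v]) v}"

lemma last_edges_subset: "last_edges j S v \<subseteq> V"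
proof
  fix u assume "u \<in> last_edges j S v"
  then obtain s F p where "sp (E - F) s (p @ u # [v]) v" by (auto simp: last_edges_def)
  then have "{u, v} \<in> E"
    using path_edges_append[of p u "[v]"] by (auto simp: sp_def walk_between_iff)
  thus "u \<in> V" using edge_subset by blast
qed

lemma finite_last_edges: "finite (last_edges j S v)"
  by (rule finite_subset[OF last_edges_subset finite_V])

text \<open>
  A sequence of faults \<open>e\<^sub>1, \<dots>, e\<^sub>r\<close> such that each \<open>e\<^sub>k\<close> is the \<open>l\<^sub>k\<close>-th edge from the end of the
  shortest path avoiding \<open>A\<close> and its predecessors.
\<close>

fun fault_sequence :: "'a \<Rightarrow> 'a \<Rightarrow> 'a set set \<Rightarrow> ('a set \<times> nat) list \<Rightarrow> bool" where
  "fault_sequence s v A [] \<longleftrightarrow> True"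
| "fault_sequence s v A ((e, l) # xs) \<longleftrightarrow>
     (\<exists>ps a b qs. sp (E - A) s (ps @ a # b # qs) v \<and> e = {a, b} \<and> l = length (b # qs)) \<and>
     fault_sequence s v (insert e A) xs"

text \<open>The shortest path avoiding the faults found so far is unique, so a position on it names
  the next fault. Counting fault sequences thus reduces to counting lists of positions.\<close>

lemma fault_sequence_determined:
  assumes "fault_sequence s v A xs" "fault_sequence s v A ys" "map snd xs = map snd ys"
  shows "xs = ys"
  using assms
proof (induction xs arbitrary: A ys)
  case (Cons z xs)
  obtain e l where z: "z = (e, l)" by (cases z)
  obtain e' ys' where ys: "ys = (e', l) # ys'" using Cons.prems(3) z by (cases ys) auto
  obtain ps a b qs where 1: "sp (E - A) s (ps @ a # b # qs) v" "e = {a, b}" "l = length (b # qs)"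
    using Cons.prems(1) z by auto
  obtain ps' a' b' qs' where 2: "sp (E - A) s (ps' @ a' # b' # qs') v" "e' = {a', b'}"
      "l = length (b' # qs')"
    using Cons.prems(2) ys by auto
  have "ps @ a # b # qs = ps' @ a' # b' # qs'" using sp_unique 1 2 by blast
  with 1 2 have "e = e'" by simp
  moreover have "xs = ys'"
    using Cons.IH[of "insert e A" ys'] Cons.prems z ys \<open>e = e'\<close> by simp
  ultimately show ?case using z ys by simp
qed simp

lemma fault_sequence_pos: "fault_sequence s v A xs \<Longrightarrow> (e, l) \<in> set xs \<Longrightarrow> 1 \<le> l"
  by (induction s v A xs rule: fault_sequence.induct) auto

text \<open>If the shortest path avoiding \<open>A\<close> meets \<open>F\<close>, one of the faults
  on it is added to \<open>A\<close>. Otherwise it survives in \<open>E - F\<close> and is already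
  the path \<open>p\<close>. Faults of \<open>F\<close> that are never met need not be
  recorded.\<close>

lemma fault_sequence_exists:
  assumes "finite F" "A \<subseteq> F" "sp (E - F) s p v"
  shows "\<exists>xs. fault_sequence s v A xs \<and> fst ` set xs \<subseteq> F \<and> length xs \<le> card (F - A) \<and>
    sp (E - (A \<union> fst ` set xs)) s p v"
  using assms(2)
proof (induction "card (F - A)" arbitrary: A rule: less_induct)
  case less
  have "walk_between (E - A) s p v"
    using walk_between_mono[OF sp_walk[OF assms(3)]] less.prems by blast
  then obtain q where q: "sp (E - A) s q v" using sp_exists by (metis Diff_subset)
  show ?case
  proof (cases "path_edges q \<inter> F = {}")
    case True
    have "walk_between (E - F) s q v"
      using True q by (auto simp: sp_def walk_between_iff)
    hence "sp (E - F) s q v" using sp_subgraph[OF q] less.prems by blast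
    hence "q = p" using assms(3) sp_unique by blast
    then show ?thesis using q by (intro exI[of _ "[]"]) auto
  next
    case False
    then obtain e where e: "e \<in> path_edges q" "e \<in> F" by blast
    have eA: "e \<notin> A" using e q by (auto simp: sp_def walk_between_iff)
    obtain ps a b qs where q_eq: "q = ps @ a # b # qs" and e_eq: "e = {a, b}"
      using path_edges_split[OF e(1)] .
    have card: "card (F - A) = Suc (card (F - insert e A))"
      using e eA assms(1) by (metis Diff_iff Diff_insert card.remove finite_Diff)
    obtain xs where "fault_sequence s v (insert e A) xs" "fst ` set xs \<subseteq> F"
        "length xs \<le> card (F - insert e A)" "sp (E - (insert e A \<union> fst ` set xs)) s p v"
      using less.hyps[of "insert e A"] card e less.prems by auto
    then show ?thesis using card e q q_eq e_eq
      by (intro exI[of _ "(e, length (b # qs)) # xs"]) auto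
  qed
qed

text \<open>
  Faults far from the end of the path at which they were discovered cannot affect short paths
  to the same endpoint.
\<close>

lemma fault_sequence_short_walk:
  assumes "fault_sequence s v A xs" "length q \<le> d + 1"
    and "walk_between (E - (A \<union> fst ` {z \<in> set xs. snd z \<le> d})) x q v"
  shows "walk_between (E - (A \<union> fst ` set xs)) x q v"
  using assms
proof (induction s v A xs rule: fault_sequence.induct)
  case (2 s v A e l xs)
  have "walk_between (E - (insert e A \<union> fst ` {z \<in> set xs. snd z \<le> d})) x q v"
  proof (cases "l \<le> d")
    case True
    have "{z \<in> set ((e, l) # xs). snd z \<le> d} = insert (e, l) {z \<in> set xs. snd z \<le> d}"
      using True by auto
    then show ?thesis using "2.prems"(3) by simp
  next
    case False
    have "{z \<in> set ((e, l) # xs). snd z \<le> d} = {z \<in> set xs. snd z \<le> d}"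
      using False by auto
    hence q: "walk_between (E - (A \<union> fst ` {z \<in> set xs. snd z \<le> d})) x q v"
      using "2.prems"(3) by simp
    \<comment> \<open>If \<open>q\<close> used \<open>e\<close>, its part from \<open>a\<close> on
      would reach \<open>v\<close> in at most \<open>d\<close> edges while avoiding
      \<open>A\<close>; but the shortest such path from \<open>a\<close> has \<open>l > d\<close>
      edges.\<close>
    have "e \<notin> path_edges q"
    proof
      assume e: "e \<in> path_edges q"
      obtain ps a b qs where p: "sp (E - A) s (ps @ a # b # qs) v" "e = {a, b}" "l = length (b # qs)"
        using "2.prems"(1) by auto
      have "a \<in> set q" using e p(2) path_edges_subset_set by fastforce
      then obtain q1 q2 where q12: "q = q1 @ a # q2" using split_list by metis
      have "walk_between (E - (A \<union> fst ` {z \<in> set xs. snd z \<le> d})) a (a # q2) v"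
        using walk_between_split q unfolding q12 by metis
      hence "walk_between (E - A) a (a # q2) v" by (rule walk_between_mono) blast
      from sp_length_le[OF sp_suffix[OF p(1)] this] have "l \<le> d"
        using p(3) "2.prems"(2) q12 by simp
      with False show False by simp
    qed
    then show ?thesis using q by (auto simp: walk_between_iff)
  qed
  from "2.IH"[OF _ "2.prems"(2) this] show ?case using "2.prems"(1) by simp
qed simp

definition sequence_last_edges :: "nat \<Rightarrow> (nat \<Rightarrow> nat) \<Rightarrow> 'a set \<Rightarrow> 'a \<Rightarrow> 'a set" where
  "sequence_last_edges j D S v = {u. \<exists>s\<in>S. \<exists>xs p. fault_sequence s v {} xs \<and>
     map snd xs \<in> dominated_lists j D \<and> sp (E - fst ` set xs) s (p @ [u, v]) v}"

text \<open>A source and a list of positions determine the faults, hence the unique shortest path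
  and its penultimate vertex; \<open>f\<close> is this map.\<close>

lemma card_sequence_last_edges:
  assumes "finite S"
  shows "finite (sequence_last_edges j D S v) \<and>
    card (sequence_last_edges j D S v) \<le> card S * (fact j * (\<Prod>i<j. D i))"
proof -
  define f where "f = (\<lambda>(s, ls). THE u. \<exists>xs p. fault_sequence s v {} xs \<and> map snd xs = ls \<and>
    sp (E - fst ` set xs) s (p @ [u, v]) v)"
  let ?I = "S \<times> dominated_lists j D"
  have sub: "sequence_last_edges j D S v \<subseteq> f ` ?I"
  proof
    fix u assume "u \<in> sequence_last_edges j D S v"
    then obtain s xs p where u: "s \<in> S" "fault_sequence s v {} xs"
      "map snd xs \<in> dominated_lists j D" "sp (E - fst ` set xs) s (p @ [u, v]) v"
      by (auto simp: sequence_last_edges_def)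
    have "f (s, map snd xs) = u" unfolding f_def prod.case
    proof (rule the_equality)
      fix u'
      assume "\<exists>ys p. fault_sequence s v {} ys \<and> map snd ys = map snd xs \<and>
        sp (E - fst ` set ys) s (p @ [u', v]) v"
      then obtain p' where "sp (E - fst ` set xs) s (p' @ [u', v]) v"
        using fault_sequence_determined[OF u(2)] by metis
      from sp_unique[OF this u(4)] show "u' = u" by simp
    qed (use u in blast)
    thus "u \<in> f ` ?I" using u by force
  qed
  have fin: "finite ?I" using assms finite_card_dominated_lists by blast
  have "card (sequence_last_edges j D S v) \<le> card ?I" using surj_card_le[OF fin sub] .
  also have "\<dots> \<le> card S * (fact j * (\<Prod>i<j. D i))"
    using finite_card_dominated_lists by (simp add: card_cartesian_product)
  finally show ?thesis using finite_subset[OF sub] fin by blast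
qed

text \<open>The last edges of long paths are of this kind: each of the \<open>d\<close> vertices
  preceding \<open>v\<close> on the path is a source for the same last edge. Having many sources is
  what lets a small set of sources capture half of them.\<close>

definition rich_last_edges :: "nat \<Rightarrow> nat \<Rightarrow> 'a \<Rightarrow> 'a set" where
  "rich_last_edges i d v =
     {u \<in> V. \<exists>X\<subseteq>V. d \<le> card X \<and> (\<forall>x\<in>X. u \<in> last_edges i {x} v)}"

lemma last_edges_UN: "last_edges i S v = (\<Union>x\<in>S. last_edges i {x} v)"
  by (auto simp: last_edges_def)

text \<open>The half hitting set is applied to the witness sets \<open>X u\<close>: a point of
  \<open>R\<close> in \<open>X u\<close> is a source whose paths have \<open>u\<close> as a last
  edge.\<close>

lemma rich_last_edges_hitting:
  assumes "1 \<le> d"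
  obtains R where "R \<subseteq> V" "card R * d \<le> 2 * card V"
    "card (rich_last_edges i d v) \<le> 2 * card (last_edges i R v)"
proof -
  have "\<forall>u\<in>rich_last_edges i d v. \<exists>X\<subseteq>V. d \<le> card X \<and> (\<forall>x\<in>X. u \<in> last_edges i {x} v)"
    by (auto simp: rich_last_edges_def)
  then obtain X where X: "\<And>u. u \<in> rich_last_edges i d v \<Longrightarrow>
      X u \<subseteq> V \<and> d \<le> card (X u) \<and> (\<forall>x\<in>X u. u \<in> last_edges i {x} v)"
    by metis
  have fin: "finite (rich_last_edges i d v)" using finite_V by (simp add: rich_last_edges_def)
  obtain R where R: "R \<subseteq> V" "card R * d \<le> 2 * card V"
    "card (rich_last_edges i d v) \<le> 2 * card {u \<in> rich_last_edges i d v. X u \<inter> R \<noteq> {}}"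
    using half_hitting_set[OF finite_V fin assms, of X] X by blast
  have "{u \<in> rich_last_edges i d v. X u \<inter> R \<noteq> {}} \<subseteq> last_edges i R v"
    using X by (subst last_edges_UN) blast
  from card_mono[OF finite_last_edges this] R that show ?thesis by fastforce
qed

text \<open>If the positions are not dominated, for some \<open>i < j\<close> at most
  \<open>i\<close> discovered faults lie within distance \<open>D i\<close> of \<open>v\<close>, and
  these alone fix the last \<open>D i\<close> edges of the path. A path no longer than that keeps
  its source in \<open>S\<close>; on a longer one, each of the last \<open>D i\<close> vertices
  before \<open>v\<close> may serve as source.\<close>

lemma last_edges_subset_cases:
  assumes D: "\<And>i. 1 \<le> D i"
  shows "last_edges j S v \<subseteq> sequence_last_edges j D S v \<union>
    (\<Union>i<j. last_edges i S v \<union> rich_last_edges i (D i) v)"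
proof
  fix u assume u: "u \<in> last_edges j S v"
  then obtain s F p where s: "s \<in> S" and F: "finite F" "card F \<le> j"
    and p: "sp (E - F) s (p @ [u, v]) v"
    by (auto simp: last_edges_def)
  obtain xs where xs: "fault_sequence s v {} xs" "length xs \<le> j"
    and px: "sp (E - fst ` set xs) s (p @ [u, v]) v"
    using fault_sequence_exists[OF F(1) _ p, of "{}"] F(2) by auto
  show "u \<in> sequence_last_edges j D S v \<union>
    (\<Union>i<j. last_edges i S v \<union> rich_last_edges i (D i) v)"
  proof (cases "map snd xs \<in> dominated_lists j D")
    case True
    then show ?thesis using s xs px by (auto simp: sequence_last_edges_def)
  next
    case False
    \<comment> \<open>A sequence with fewer than \<open>j\<close> faults fails at
      \<open>i = length xs\<close>; a full one fails by the definition of dominated lists, as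
      positions are at least 1.\<close>
    have "\<exists>i<j. length (filter (\<lambda>l. l \<le> D i) (map snd xs)) \<le> i"
    proof (cases "length xs = j")
      case True
      then show ?thesis using False fault_sequence_pos[OF xs(1)]
        by (force simp: dominated_lists_def not_less)
    next
      case False
      hence "length xs < j" using xs(2) by simp
      then show ?thesis
        by (intro exI[of _ "length xs"]) (metis length_filter_le length_map)
    qed
    then obtain i where i: "i < j" "length (filter (\<lambda>l. l \<le> D i) (map snd xs)) \<le> i" by blast
    define G where "G = fst ` {z \<in> set xs. snd z \<le> D i}"
    have "G = set (map fst (filter (\<lambda>z. snd z \<le> D i) xs))" by (auto simp: G_def)
    hence "card G \<le> length (map fst (filter (\<lambda>z. snd z \<le> D i) xs))" by (metis card_length)
    hence G: "finite G" "card G \<le> i" "G \<subseteq> fst ` set xs"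
      using i(2) by (auto simp: G_def filter_map o_def)
    \<comment> \<open>The shortest path avoiding only \<open>G\<close> has at most
      \<open>D i\<close> edges, so it avoids the remaining faults as well and coincides with the
      given one.\<close>
    have suffix: "sp (E - G) x (r @ [u, v]) v"
      if r: "sp (E - fst ` set xs) x (r @ [u, v]) v" "length (r @ [u, v]) \<le> D i + 1" for x r
    proof -
      have wb: "walk_between (E - G) x (r @ [u, v]) v"
        using walk_between_mono[OF sp_walk[OF r(1)]] G(3) by blast
      then obtain q where q: "sp (E - G) x q v" using sp_exists by (metis Diff_subset)
      have "length q \<le> D i + 1" using sp_length_le[OF q wb] r(2) by simp
      hence "walk_between (E - ({} \<union> fst ` set xs)) x q v"
        by (rule fault_sequence_short_walk[OF xs(1)]) (use q in \<open>simp add: sp_def G_def\<close>)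
      hence "sp (E - fst ` set xs) x q v" using sp_subgraph[OF q] G(3) by auto
      with r(1) q show ?thesis using sp_unique by blast
    qed
    have last: "u \<in> last_edges i {x} v"
      if "sp (E - fst ` set xs) x (r @ [u, v]) v" "length (r @ [u, v]) \<le> D i + 1" for x r
      using suffix[OF that] G by (auto simp: last_edges_def)
    show ?thesis
    proof (cases "length (p @ [u, v]) \<le> D i + 1")
      case True
      then have "u \<in> last_edges i S v" using last[OF px] s by (subst last_edges_UN) blast
      with i(1) show ?thesis by blast
    next
      case False
      \<comment> \<open>\<open>X\<close> consists of the \<open>D i\<close> vertices just before
        \<open>v\<close>, with \<open>v\<close> itself left out. The subpath from any of them then
        has at most \<open>D i\<close> edges, that is, \<open>D i + 1\<close> vertices.\<close>
      define k where "k = length p + 1 - D i"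
      define X where "X = set (drop k (p @ [u]))"
      have k: "k + D i = length p + 1" using False by (simp add: k_def)
      have "distinct (p @ [u])" using sp_distinct[OF px] by simp
      hence "card X = length (drop k (p @ [u]))"
        unfolding X_def by (intro distinct_card distinct_drop)
      hence "card X = D i" using k by simp
      moreover have "X \<subseteq> V"
      proof -
        have "X \<subseteq> set (p @ [u, v])" unfolding X_def using set_drop_subset[of k "p @ [u]"] by auto
        also have "\<dots> \<subseteq> \<Union> (path_edges (p @ [u, v]))" by (rule set_subset_path_edges) simp
        also have "\<dots> \<subseteq> V" using sp_subset[OF px] edge_subset by blast
        finally show ?thesis .
      qed
      moreover have "u \<in> last_edges i {x} v" if x: "x \<in> X" for x
      proof -
        have kp: "k \<le> length p" using k D[of i] by simp
        hence "x \<in> set (drop k p @ [u])" using x by (simp add: X_def)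
        then obtain a b where ab: "drop k p @ [u] = a @ x # b" using split_list by metis
        have full: "p @ [u, v] = (take k p @ a) @ x # (b @ [v])"
        proof -
          have "p @ [u, v] = take k p @ (drop k p @ [u]) @ [v]" by simp
          thus ?thesis unfolding ab by simp
        qed
        have len: "length (x # b) \<le> D i"
          using arg_cong[OF ab, of length] k kp by simp
        obtain r where r: "x # b = r @ [u]"
        proof (cases b rule: rev_cases)
          case Nil
          then show ?thesis using ab that[of "[]"] by simp
        next
          case (snoc b' z)
          then show ?thesis using ab that[of "x # b'"] by simp
        qed
        have "sp (E - fst ` set xs) x (x # (b @ [v])) v"
          using px unfolding full by (rule sp_suffix)
        moreover have "x # (b @ [v]) = r @ [u, v]" using r by (metis append_Cons append_assoc append_Nil)
        ultimately show ?thesis using last[of x r] len r by (metis length_Cons length_append_singleton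
          add.commute append_Cons plus_1_eq_Suc Suc_le_mono)
      qed
      moreover have "u \<in> V" using u last_edges_subset by blast
      ultimately have "u \<in> rich_last_edges i (D i) v"
        by (auto simp: rich_last_edges_def intro!: exI[of _ X])
      with i(1) show ?thesis by blast
    qed
  qed
qed

text \<open>The source set and the real parameter \<open>y\<close> vary in the induction, since the
  recursion passes to a hitting set \<open>R\<close> and to \<open>y / 2\<close>.\<close>

lemma card_last_edges:
  fixes y :: real
  assumes "finite S" "0 < y" "card S * y ^ 2 ^ j \<le> card V"
  shows "card (last_edges j S v) * y \<le> last_edges_const j * card V"
  using assms
proof (induction j arbitrary: S y rule: less_induct)
  case (less j)
  note y = \<open>0 < y\<close>
  let ?n = "real (card V)"
  show ?case
  proof (cases "1 \<le> y")
    \<comment> \<open>For \<open>y < 1\<close> the trivial bound \<open>card V\<close>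
      suffices.\<close>
    case False
    have "card (last_edges j S v) * y \<le> ?n * 1"
      using False y card_mono[OF finite_V last_edges_subset] by (intro mult_mono) auto
    also have "\<dots> \<le> last_edges_const j * ?n"
      using mult_right_mono[OF last_edges_const_ge_1[of j], of ?n] by simp
    finally show ?thesis .
  next
    case True
    \<comment> \<open>Rounding up at most doubles a number that is at least 1; this is the source of
      the factor \<open>2 ^ j\<close>.\<close>
    define D where "D i = nat \<lceil>y ^ 2 ^ i\<rceil>" for i
    have y_pow: "1 \<le> y ^ 2 ^ i" for i :: nat using True by simp
    have D_ge: "y ^ 2 ^ i \<le> D i" and D_le: "D i \<le> 2 * y ^ 2 ^ i" for i
      using y_pow[of i] by (simp_all add: D_def, linarith+)
    have D1: "1 \<le> D i" for i using D_ge[of i] y_pow[of i] by linarith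
    \<comment> \<open>The exponents \<open>2 ^ i\<close> for \<open>i < j\<close> add up to
      \<open>2 ^ j - 1\<close>, so one further factor \<open>y\<close> yields exactly the power in
      the hypothesis on \<open>S\<close>.\<close>
    have prod_y: "(\<Prod>i<j. y ^ 2 ^ i) * y = y ^ 2 ^ j"
    proof (induction j)
      case (Suc j)
      have "(\<Prod>i<Suc j. y ^ 2 ^ i) * y = ((\<Prod>i<j. y ^ 2 ^ i) * y) * y ^ 2 ^ j" by simp
      also have "\<dots> = y ^ 2 ^ Suc j" unfolding Suc by (simp add: mult_2 flip: power_add)
      finally show ?case .
    qed simp
    have seq: "card (sequence_last_edges j D S v) * y \<le> fact j * 2 ^ j * ?n"
    proof -
      have "real (\<Prod>i<j. D i) \<le> (\<Prod>i<j. 2 * y ^ 2 ^ i)"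
        using D_le by (simp add: prod_mono)
      also have "\<dots> = 2 ^ j * (\<Prod>i<j. y ^ 2 ^ i)" by (simp add: prod.distrib)
      finally have prod_D: "real (\<Prod>i<j. D i) \<le> 2 ^ j * (\<Prod>i<j. y ^ 2 ^ i)" .
      have "real (card (sequence_last_edges j D S v)) \<le> real (card S * (fact j * (\<Prod>i<j. D i)))"
        using card_sequence_last_edges[OF less.prems(1)] of_nat_le_iff by blast
      also have "\<dots> \<le> card S * (fact j * (2 ^ j * (\<Prod>i<j. y ^ 2 ^ i)))"
        unfolding of_nat_mult of_nat_fact by (intro mult_left_mono prod_D) auto
      finally have "card (sequence_last_edges j D S v) * y \<le>
          card S * (fact j * (2 ^ j * (\<Prod>i<j. y ^ 2 ^ i))) * y"
        using y by (intro mult_right_mono) auto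
      also have "\<dots> = fact j * 2 ^ j * (card S * ((\<Prod>i<j. y ^ 2 ^ i) * y))" by simp
      also have "\<dots> \<le> fact j * 2 ^ j * ?n"
        unfolding prod_y using less.prems(3) by (intro mult_left_mono) auto
      finally show ?thesis .
    qed
    have short: "card (last_edges i S v) * y \<le> last_edges_const i * ?n" if "i < j" for i
    proof (rule less.IH[OF that less.prems(1,2)])
      have "y ^ 2 ^ i \<le> y ^ 2 ^ j" using True that by (intro power_increasing) auto
      hence "card S * y ^ 2 ^ i \<le> card S * y ^ 2 ^ j" by (intro mult_left_mono) auto
      with less.prems(3) show "card S * y ^ 2 ^ i \<le> ?n" by linarith
    qed
    have rich: "card (rich_last_edges i (D i) v) * y \<le> 4 * (last_edges_const i * ?n)" if "i < j" for i
    proof -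
      obtain R where R: "R \<subseteq> V" "card R * D i \<le> 2 * card V"
        "card (rich_last_edges i (D i) v) \<le> 2 * card (last_edges i R v)"
        using rich_last_edges_hitting[OF D1] .
      \<comment> \<open>Passing to \<open>y / 2\<close> absorbs the factor 2 in the size of
        \<open>R\<close>. Together with the factor 2 for hitting only half of the sets this gives
        the 4 in \<open>rich\<close>.\<close>
      have "(y / 2) ^ 2 ^ i \<le> y ^ 2 ^ i / 2"
      proof -
        have "(2::real) ^ 1 \<le> 2 ^ 2 ^ i" by (intro power_increasing) auto
        hence "y ^ 2 ^ i / 2 ^ 2 ^ i \<le> y ^ 2 ^ i / 2"
          using y_pow[of i] by (intro divide_left_mono) auto
        thus ?thesis by (simp add: power_divide)
      qed
      hence "card R * (y / 2) ^ 2 ^ i \<le> card R * (D i / 2)"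
        using D_ge[of i] by (intro mult_left_mono) auto
      also have "\<dots> \<le> ?n"
        using R(2) by (simp flip: of_nat_mult)
      finally have "card (last_edges i R v) * (y / 2) \<le> last_edges_const i * ?n"
        using y R(1) finite_V finite_subset by (intro less.IH[OF that]) auto
      moreover have "card (rich_last_edges i (D i) v) * y \<le> real (2 * card (last_edges i R v)) * y"
        using R(3) y by (intro mult_right_mono) auto
      ultimately show ?thesis by simp
    qed
    have "card (last_edges j S v) \<le> card (sequence_last_edges j D S v \<union>
        (\<Union>i<j. last_edges i S v \<union> rich_last_edges i (D i) v))"
    proof (rule card_mono[OF _ last_edges_subset_cases[OF D1]])
      show "finite (sequence_last_edges j D S v \<union>
          (\<Union>i<j. last_edges i S v \<union> rich_last_edges i (D i) v))"
        using finite_last_edges card_sequence_last_edges[OF less.prems(1)] finite_V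
        by (auto simp: rich_last_edges_def)
    qed
    also have "\<dots> \<le> card (sequence_last_edges j D S v) +
        (\<Sum>i<j. card (last_edges i S v) + card (rich_last_edges i (D i) v))"
      by (intro order_trans[OF card_Un_le] add_mono order_trans[OF card_UN_le] sum_mono card_Un_le) auto
    finally have "real (card (last_edges j S v)) \<le> card (sequence_last_edges j D S v) +
        (\<Sum>i<j. real (card (last_edges i S v)) + card (rich_last_edges i (D i) v))"
      by (simp flip: of_nat_add of_nat_sum)
    hence "card (last_edges j S v) * y \<le> (card (sequence_last_edges j D S v) +
        (\<Sum>i<j. real (card (last_edges i S v)) + card (rich_last_edges i (D i) v))) * y"
      using y by (intro mult_right_mono) auto
    also have "\<dots> = card (sequence_last_edges j D S v) * y +
        (\<Sum>i<j. card (last_edges i S v) * y + card (rich_last_edges i (D i) v) * y)"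
      by (simp add: distrib_right sum_distrib_right)
    also have "\<dots> \<le> fact j * 2 ^ j * ?n + (\<Sum>i<j. 5 * last_edges_const i * ?n)"
      using short rich by (intro add_mono seq sum_mono) force
    also have "\<dots> = (fact j * 2 ^ j + (\<Sum>i<j. 5 * last_edges_const i)) * ?n"
      by (simp add: distrib_right sum_distrib_right)
    also have "\<dots> \<le> last_edges_const j * ?n"
      by (intro mult_right_mono last_edges_const_rec) auto
    finally show ?thesis .
  qed
qed

section \<open>The edges stored in a label: their number and sufficiency\<close>

definition label_edges :: "nat \<Rightarrow> 'a \<Rightarrow> 'a set set" where
  "label_edges f s =
     {e. \<exists>F p t. finite F \<and> card F \<le> f \<and> sp (E - F) s p t \<and> e \<in> path_edges p}"

lemma label_edges_subset: "label_edges f s \<subseteq> E"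
  using sp_subset unfolding label_edges_def by blast

text \<open>An edge of a shortest path is the last edge of a prefix, which is itself a shortest
  path. So the bound for the single source \<open>s\<close> is summed over all endpoints.\<close>

lemma card_label_edges:
  fixes y :: real
  assumes "0 < y" "y ^ 2 ^ f \<le> card V"
  shows "card (label_edges f s) * y \<le> last_edges_const f * card V * card V"
proof -
  have "label_edges f s \<subseteq> (\<Union>v\<in>V. (\<lambda>u. {u, v}) ` last_edges f {s} v)"
  proof
    fix e assume "e \<in> label_edges f s"
    then obtain F p t where F: "finite F" "card F \<le> f" "sp (E - F) s p t" "e \<in> path_edges p"
      by (auto simp: label_edges_def)
    obtain ps a b qs where p: "p = ps @ a # b # qs" "e = {a, b}"
      using path_edges_split[OF F(4)] .
    have "sp (E - F) s ((ps @ [a]) @ b # qs) t" using F p by simp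
    from sp_prefix[OF this] have "a \<in> last_edges f {s} b"
      using F by (auto simp: last_edges_def)
    moreover have "b \<in> V" using F p sp_subset edge_subset by blast
    ultimately show "e \<in> (\<Union>v\<in>V. (\<lambda>u. {u, v}) ` last_edges f {s} v)" using p by blast
  qed
  hence "card (label_edges f s) \<le> card (\<Union>v\<in>V. (\<lambda>u. {u, v}) ` last_edges f {s} v)"
    using finite_V finite_last_edges by (intro card_mono) auto
  also have "\<dots> \<le> (\<Sum>v\<in>V. card (last_edges f {s} v))"
    using finite_V finite_last_edges
    by (intro order_trans[OF card_UN_le] sum_mono card_image_le) auto
  finally have "real (card (label_edges f s)) \<le> (\<Sum>v\<in>V. real (card (last_edges f {s} v)))"
    by (simp flip: of_nat_sum)
  hence "card (label_edges f s) * y \<le> (\<Sum>v\<in>V. real (card (last_edges f {s} v))) * y"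
    using assms by (intro mult_right_mono) auto
  also have "\<dots> = (\<Sum>v\<in>V. card (last_edges f {s} v) * y)" by (rule sum_distrib_right)
  also have "\<dots> \<le> (\<Sum>v\<in>V. last_edges_const f * card V)"
    using assms by (intro sum_mono card_last_edges) auto
  finally show ?thesis by (simp add: mult_ac)
qed

text \<open>Under at most \<open>f\<close> faults the stored edges of \<open>s\<close> contain the
  shortest path itself. Under \<open>f + 1\<close> faults one fault \<open>e\<close> is put back;
  restoration in the larger graph gives paths from \<open>s\<close> and from \<open>t\<close> that
  avoid \<open>e\<close>, each selected under only \<open>f\<close> faults.\<close>

lemma label_edges_graph_dist:
  assumes F: "F \<subseteq> E" "finite F" "card F \<le> f + 1"
  shows "graph_dist (label_edges f s \<union> label_edges f t - F) s t = graph_dist (E - F) s t"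
proof (rule antisym)
  let ?H = "label_edges f s \<union> label_edges f t - F"
  have "?H \<subseteq> E - F" using label_edges_subset by blast
  thus "graph_dist (E - F) s t \<le> graph_dist ?H s t" by (rule graph_dist_antimono)
  show "graph_dist ?H s t \<le> graph_dist (E - F) s t"
  proof (cases "\<exists>p. walk_between (E - F) s p t")
    case False
    then show ?thesis by (simp add: graph_dist_infinity)
  next
    case True
    then obtain P where P: "sp (E - F) s P t" using sp_exists by (metis Diff_subset)
    show ?thesis
    proof (cases "card F \<le> f")
      case True
      have "path_edges P \<subseteq> label_edges f s" using P True F(2) by (auto simp: label_edges_def)
      hence "walk_between ?H s P t" using sp_walk[OF P] by (auto simp: walk_between_iff)
      from graph_dist_le[OF this] show ?thesis using sp_graph_dist[OF P] by simp
    next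
      case False
      then obtain e where e: "e \<in> F" by fastforce
      define F' where "F' = F - {e}"
      have F': "finite F'" "card F' \<le> f" "F = insert e F'"
        using e F by (auto simp: F'_def)
      have eq: "E - F = (E - F') - {e}" using F' by auto
      obtain x p q where pq: "sp (E - F') s p x" "sp (E - F') t q x"
        "e \<notin> path_edges p" "e \<notin> path_edges q" "length p + length q = length P + 1"
        by (rule restoration[OF _ sp_walk[OF P, unfolded eq] sp_length_le[OF P, unfolded eq]]) auto
      have "path_edges p \<subseteq> label_edges f s" "path_edges q \<subseteq> label_edges f t"
        using pq F' by (auto simp: label_edges_def)
      hence "walk_between ?H s p x" "walk_between ?H t q x"
        using pq F' by (auto simp: sp_def walk_between_iff)
      hence "walk_between ?H s (p @ tl (rev q)) t"
        by (intro walk_between_concat walk_between_rev)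
      from graph_dist_le[OF this]
      have "graph_dist ?H s t \<le> enat (length p + (length q - 1) - 1)" by simp
      also have "length p + (length q - 1) - 1 = length P - 1"
      proof -
        have "q \<noteq> []" using pq by (auto simp: sp_def walk_between_iff)
        thus ?thesis using pq(5) by (cases q) auto
      qed
      finally show ?thesis using sp_graph_dist[OF P] by simp
    qed
  qed
qed

end

section \<open>Antisymmetric weights\<close>

definition edge_index :: "nat \<Rightarrow> nat \<Rightarrow> nat" where
  "edge_index x y = prod_encode (min x y, max x y)"

definition edge_sign :: "nat \<Rightarrow> nat \<Rightarrow> int" where
  "edge_sign x y = (if x < y then 1 else - 1)"

text \<open>Summed along a walk by \<open>path_weight\<close>, this is the net number of traversals
  of edge number \<open>i\<close>: upward ones minus downward ones.\<close>

definition usage :: "nat \<Rightarrow> nat \<Rightarrow> nat \<Rightarrow> int" where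
  "usage i x y = (if edge_index x y = i then edge_sign x y else 0)"

lemma edge_index_eq: "edge_index x y = edge_index a b \<longleftrightarrow> {x, y} = {a, b}"
  by (auto simp: edge_index_def prod_encode_eq doubleton_eq_iff min_def max_def split: if_splits)

lemma usage_same: "usage (edge_index x y) x y = edge_sign x y"
  and usage_other: "edge_index x y \<noteq> i \<Longrightarrow> usage i x y = 0"
  by (simp_all add: usage_def)

lemma path_usage_notin: "x \<notin> set p \<Longrightarrow> path_weight (usage (edge_index x y)) p = 0"
  by (induction p rule: path_edges.induct) (auto simp: usage_def edge_index_eq doubleton_eq_iff)

lemma abs_path_usage_le: "distinct p \<Longrightarrow> \<bar>path_weight (usage i) p\<bar> \<le> 1"
proof (induction p rule: path_edges.induct)
  case (1 x y p)
  then show ?case using path_usage_notin[of x "y # p" y]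
    by (cases "edge_index x y = i") (auto simp: usage_same usage_other edge_sign_def)
qed auto

text \<open>The first edge of \<open>p\<close> has nonzero net usage, so \<open>q\<close> uses it
  too. Since \<open>q\<close> visits its starting point only once, that edge is also the first edge
  of \<open>q\<close>.\<close>

lemma path_usage_inj:
  assumes "distinct p" "distinct q" "p \<noteq> []" "q \<noteq> []" "hd p = hd q"
    and "\<And>i. path_weight (usage i) p = path_weight (usage i) q"
  shows "p = q"
  using assms
proof (induction p arbitrary: q rule: path_edges.induct)
  case (1 x y p)
  obtain q' where q: "q = x # q'" using "1.prems" by (cases q) auto
  have u: "path_weight (usage (edge_index x y)) (x # y # p) \<noteq> 0"
    using path_usage_notin[of x "y # p" y] "1.prems"(1) by (auto simp: usage_def edge_sign_def)
  show ?case
  proof (cases q')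
    case Nil
    with "1.prems"(6) q u show ?thesis by simp
  next
    case (Cons z q'')
    have "path_weight (usage (edge_index x y)) (z # q'') = 0"
      using path_usage_notin[of x "z # q''" y] "1.prems"(2) q Cons by auto
    hence "usage (edge_index x y) x z \<noteq> 0" using u "1.prems"(6) q Cons by simp
    hence z: "z = y" by (auto simp: usage_def edge_index_eq doubleton_eq_iff split: if_splits)
    have "y # p = q'"
      using "1.prems" q Cons z by (intro "1.IH") auto
    then show ?thesis using q by simp
  qed
next
  case ("2_2" x)
  show ?case
  proof (cases q rule: path_edges.cases)
    case (1 a b q')
    have "path_weight (usage (edge_index a b)) q \<noteq> 0"
      using path_usage_notin[of a "b # q'" b] "2_2.prems"(2) 1
      by (auto simp: usage_def edge_sign_def)
    with "2_2.prems"(6) show ?thesis by (metis path_weight.simps(3))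
  qed (use "2_2.prems" in auto)
qed auto

text \<open>Modulo 3 the sum leaves \<open>c 0\<close>, which vanishes because it is at most 2 in
  absolute value; then divide by 3. The range up to 2 fits differences of two net usages.\<close>

lemma ternary_expansion_unique:
  fixes c :: "nat \<Rightarrow> int"
  assumes "\<And>i. \<bar>c i\<bar> \<le> 2" "(\<Sum>i<m. c i * 3 ^ i) = 0" "i < m"
  shows "c i = 0"
  using assms
proof (induction m arbitrary: c i)
  case (Suc m)
  have "(\<Sum>i<Suc m. c i * 3 ^ i) = c 0 + 3 * (\<Sum>i<m. c (Suc i) * 3 ^ i)"
    by (subst sum.lessThan_Suc_shift) (simp add: sum_distrib_left algebra_simps)
  hence eq: "c 0 + 3 * (\<Sum>i<m. c (Suc i) * 3 ^ i) = 0" using Suc.prems by simp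
  have c0: "c 0 = 0" using eq Suc.prems(1)[of 0] by presburger
  hence "(\<Sum>i<m. c (Suc i) * 3 ^ i) = 0" using eq by simp
  hence "c (Suc i) = 0" if "i < m" for i
    using Suc.IH[of "\<lambda>i. c (Suc i)"] Suc.prems(1) that by blast
  then show ?case using c0 Suc.prems(3) by (cases i) auto
qed simp

lemma tiebreaking_exists:
  fixes V :: "nat set"
  assumes graph: "simple_graph V E"
  obtains w M where "tiebreaking V E w M"
proof -
  have V: "finite V" and E: "\<And>e. e \<in> E \<Longrightarrow> e \<subseteq> V \<and> card e = 2"
    using graph by (auto simp: simple_graph_def)
  obtain N where N: "\<And>x y. x \<in> V \<Longrightarrow> y \<in> V \<Longrightarrow> edge_index x y < N"
  proof -
    have "finite ((\<lambda>(x, y). edge_index x y) ` (V \<times> V))" using V by simp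
    then obtain N where "\<forall>k\<in>(\<lambda>(x, y). edge_index x y) ` (V \<times> V). k < N"
      using finite_nat_set_iff_bounded by blast
    hence "edge_index x y < N" if "x \<in> V" "y \<in> V" for x y using that by auto
    thus ?thesis by (rule that)
  qed
  define B :: nat where "B = 3 ^ N"
  \<comment> \<open>Each step weighs between \<open>M - B\<close> and \<open>M + B\<close>. For
    length to take precedence, \<open>(M + B) * k < (M - B) * (k + 1)\<close> must hold for every
    \<open>k \<le> card V\<close>, that is, \<open>B * (2 * k + 1) < M\<close>.\<close>
  define M where "M = B * (2 * card V + 3)"
  define w where "w x y = nat (int M + edge_sign x y * 3 ^ edge_index x y)" for x y
  have B: "1 \<le> B" by (simp add: B_def)
  have BM: "B < M"
    using mult_le_mono2[of 3 "2 * card V + 3" B] B unfolding M_def by linarith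
  have index: "edge_index x y < N" if "{x, y} \<in> E" for x y
    using E[OF that] N by simp
  have pow: "(3::int) ^ edge_index x y \<le> int B" if "{x, y} \<in> E" for x y
    using index[OF that] by (simp add: B_def power_increasing)
  have w: "int (w x y) = int M + edge_sign x y * 3 ^ edge_index x y" if "{x, y} \<in> E" for x y
    using pow[OF that] BM by (auto simp: w_def edge_sign_def)
  have w_bounds: "M - B \<le> w x y" "w x y \<le> M + B" if "{x, y} \<in> E" for x y
  proof -
    have "int M - int B \<le> int (w x y)" "int (w x y) \<le> int M + int B"
      using w[OF that] pow[OF that] zero_le_power[of "3 :: int" "edge_index x y"]
      unfolding edge_sign_def by (simp split: if_splits; linarith)+
    thus "M - B \<le> w x y" "w x y \<le> M + B" by linarith+
  qed
  have lower: "(M - B) * (length p - 1) \<le> path_weight w p"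
    and upper: "path_weight w p \<le> (M + B) * (length p - 1)" if "path_edges p \<subseteq> E" for p
    using that
    by (induction p rule: path_edges.induct) (auto intro!: add_mono w_bounds)
  have shorter: "path_weight w p < path_weight w q"
    if ne: "p \<noteq> []" and p: "distinct p" "path_edges p \<subseteq> E" and q: "path_edges q \<subseteq> E" "length p < length q" for p q
  proof -
    have len: "length p \<le> card V + 1"
    proof (cases "2 \<le> length p")
      case True
      have "set p \<subseteq> V" using set_subset_path_edges[OF True] p(2) E by blast
      thus ?thesis using card_mono[OF V, of "set p"] distinct_card[OF p(1)] by simp
    qed simp
    define k where "k = length p - 1"
    have kV: "k \<le> card V" using len by (simp add: k_def)
    have k: "length p = k + 1" using ne by (cases p) (auto simp: k_def)
    have "path_weight w p \<le> (M + B) * k" using upper[OF p(2)] by (simp add: k_def)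
    also have "\<dots> < (M - B) * (k + 1)"
    proof -
      have "B * (2 * k + 1) < M" unfolding M_def using B kV by (intro mult_strict_left_mono) auto
      then obtain r where "M = B * (2 * k + 1) + r" "0 < r" using less_imp_add_positive by blast
      thus ?thesis by (simp add: algebra_simps)
    qed
    also have "\<dots> \<le> (M - B) * (length q - 1)" using q(2) k by (intro mult_left_mono) auto
    also have "\<dots> \<le> path_weight w q" using lower[OF q(1)] .
    finally show ?thesis .
  qed
  have expand: "int (path_weight w p) =
      int M * int (length p - 1) + (\<Sum>i<N. path_weight (usage i) p * 3 ^ i)"
    if "path_edges p \<subseteq> E" for p
    using that
  proof (induction p rule: path_edges.induct)
    case (1 x y p)
    have xy: "{x, y} \<in> E" using 1 by simp
    have "(\<Sum>i<N. usage i x y * 3 ^ i) = (\<Sum>i<N. if i = edge_index x y then edge_sign x y * 3 ^ i else 0)"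
      by (intro sum.cong) (auto simp: usage_def)
    also have "\<dots> = edge_sign x y * 3 ^ edge_index x y" using index[OF xy] by simp
    finally show ?case using 1 w[OF xy] by (simp add: distrib_right sum.distrib algebra_simps)
  qed auto
  have "tiebreaking V E w M"
  proof
    show "simple_graph V E" by (rule graph)
  next
    fix u v assume "{u, v} \<in> E"
    thus "0 < w u v" using w_bounds(1)[of u v] BM by linarith
  next
    fix u v assume uv: "{u, v} \<in> E"
    hence "u \<noteq> v" using E[OF uv] by auto
    moreover have "edge_index u v = edge_index v u" by (simp add: edge_index_eq insert_commute)
    moreover have "{v, u} \<in> E" using uv by (simp add: insert_commute)
    ultimately have "int (w u v) + int (w v u) = 2 * int M"
      using w[OF uv] w[of v u] by (auto simp: edge_sign_def)
    thus "w u v + w v u = 2 * M" by linarith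
  next
    fix p q :: "nat list"
    assume "p \<noteq> []" "distinct p" "path_edges p \<subseteq> E" "path_edges q \<subseteq> E" "length p < length q"
    thus "path_weight w p < path_weight w q" by (rule shorter)
  next
    fix p q :: "nat list"
    assume p: "distinct p" and q: "distinct q" and pE: "path_edges p \<subseteq> E" and qE: "path_edges q \<subseteq> E"
      and ne: "p \<noteq> []" "q \<noteq> []" and hd: "hd p = hd q" and eq: "path_weight w p = path_weight w q"
    \<comment> \<open>Equal weights force equal lengths, so the multiples of \<open>M\<close> cancel
      and only the ternary expansions of the net usages remain to be compared.\<close>
    have "length p = length q"
      using shorter[OF ne(1) p pE qE] shorter[OF ne(2) q qE pE] eq by (metis linorder_neqE_nat less_irrefl)
    hence "(\<Sum>i<N. (path_weight (usage i) p - path_weight (usage i) q) * 3 ^ i) = 0"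
      using expand[OF pE] expand[OF qE] eq by (simp add: left_diff_distrib sum_subtractf)
    moreover have "\<bar>path_weight (usage i) p - path_weight (usage i) q\<bar> \<le> 2" for i
      using abs_path_usage_le[OF p, of i] abs_path_usage_le[OF q, of i] by linarith
    ultimately have small: "path_weight (usage i) p = path_weight (usage i) q" if "i < N" for i
      using ternary_expansion_unique[of "\<lambda>i. path_weight (usage i) p - path_weight (usage i) q" N i]
        that by simp
    have large: "path_weight (usage i) r = 0" if "path_edges r \<subseteq> E" "N \<le> i" for i r
      using that
      by (induction r rule: path_edges.induct) (use index in \<open>fastforce simp: usage_def\<close>)+
    show "p = q"
      using small large pE qE by (intro path_usage_inj[OF p q ne hd]) (metis not_le)
  qed
  thus ?thesis by (rule that)
qed

section \<open>Bit strings\<close>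

text \<open>A self-delimiting code: \<open>True\<close> announces a further binary digit and
  \<open>False\<close> ends the number, so codes can be concatenated without separators.\<close>

fun encode_nat :: "nat \<Rightarrow> bool list" where
  "encode_nat n = (if n = 0 then [False] else True # odd n # encode_nat (n div 2))"

declare encode_nat.simps [simp del]

lemma encode_nat_neq_Nil: "encode_nat n \<noteq> []"
  by (subst encode_nat.simps) simp

lemma encode_nat_append_eq: "encode_nat m @ xs = encode_nat n @ ys \<Longrightarrow> m = n \<and> xs = ys"
proof (induction m arbitrary: n rule: less_induct)
  case (less m)
  show ?case
  proof (cases "m = 0 \<or> n = 0")
    case True
    then show ?thesis
      using less.prems by (auto simp: encode_nat.simps[of m] encode_nat.simps[of n] split: if_splits)
  next
    case False
    hence eq: "odd m = odd n" "encode_nat (m div 2) @ xs = encode_nat (n div 2) @ ys"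
      using less.prems by (simp_all add: encode_nat.simps[of m] encode_nat.simps[of n])
    have "m div 2 = n div 2 \<and> xs = ys" using less.IH[OF _ eq(2)] False by simp
    with eq(1) show ?thesis by (metis bit_eq_rec even_iff_mod_2_eq_zero)
  qed
qed

lemma length_encode_nat: "n < 2 ^ k \<Longrightarrow> length (encode_nat n) \<le> 2 * k + 1"
proof (induction k arbitrary: n)
  case (Suc k)
  then show ?case using Suc.IH[of "n div 2"] by (subst encode_nat.simps) auto
qed (simp add: encode_nat.simps)

definition encode_nats :: "nat list \<Rightarrow> bool list" where
  "encode_nats ns = concat (map encode_nat ns)"

lemma inj_encode_nats: "inj encode_nats"
proof (rule injI)
  fix ms ns assume "encode_nats ms = encode_nats ns"
  thus "ms = ns"
  proof (induction ms arbitrary: ns)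
    case Nil
    then show ?case by (cases ns) (auto simp: encode_nats_def encode_nat_neq_Nil)
  next
    case (Cons m ms)
    show ?case
    proof (cases ns)
      case Nil
      with Cons.prems show ?thesis by (auto simp: encode_nats_def encode_nat_neq_Nil)
    next
      case (Cons n ns')
      with Cons.prems have "m = n \<and> encode_nats ms = encode_nats ns'"
        by (intro encode_nat_append_eq) (simp add: encode_nats_def)
      with Cons Cons.IH[of ns'] show ?thesis by simp
    qed
  qed
qed

lemma length_encode_nats:
  assumes "\<And>n. n \<in> set ns \<Longrightarrow> n < 2 ^ k"
  shows "length (encode_nats ns) \<le> length ns * (2 * k + 1)"
proof -
  have "length (encode_nats ns) = (\<Sum>n\<leftarrow>ns. length (encode_nat n))"
    by (simp add: encode_nats_def length_concat o_def)
  also have "\<dots> \<le> (\<Sum>n\<leftarrow>ns. 2 * k + 1)"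
    using assms by (intro sum_list_mono length_encode_nat) auto
  finally show ?thesis by (simp add: sum_list_triv)
qed

section \<open>Encoding of edge sets and labels\<close>

definition encode_edge :: "nat set \<Rightarrow> nat" where
  "encode_edge e = prod_encode (Min e, Max e)"

definition decode_edge :: "nat \<Rightarrow> nat set" where
  "decode_edge k = {fst (prod_decode k), snd (prod_decode k)}"

lemma decode_encode_edge: "card e = 2 \<Longrightarrow> decode_edge (encode_edge e) = e"
  by (cases "Min e \<le> Max e")
    (auto simp: card_2_iff decode_edge_def encode_edge_def min_def max_def split: if_splits)

lemma triangle_le: "triangle n \<le> n * n"
  by (induction n) auto

lemma encode_edge_less:
  assumes "card e = 2" "e \<subseteq> {..<2 ^ k}"
  shows "encode_edge e < 2 ^ (2 * k + 2)"
proof -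
  have e: "finite e" "e \<noteq> {}" using assms(1) by (auto simp: card_2_iff)
  define a b where "a = Min e" and "b = Max e"
  have ab: "a < 2 ^ k" "b < 2 ^ k"
    using Min_in[OF e] Max_in[OF e] assms(2) by (auto simp: a_def b_def)
  have "encode_edge e = triangle (a + b) + a"
    by (simp add: encode_edge_def prod_encode_def a_def b_def)
  also have "\<dots> \<le> (a + b) * (a + b) + (a + b)" using triangle_le[of "a + b"] by simp
  also have "\<dots> = (a + b) * (a + b + 1)" by simp
  also have "\<dots> < (2 * 2 ^ k) * (2 * 2 ^ k)"
    using ab by (intro mult_less_le_imp_less) auto
  also have "\<dots> = 2 ^ (2 * k + 2)" by (simp add: power_add mult_2 distrib_left distrib_right)
  finally show ?thesis .
qed

text \<open>The vertex comes first because the decoder receives only labels and must recover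
  \<open>s\<close> and \<open>t\<close> from them.\<close>

definition make_label :: "nat \<Rightarrow> nat set set \<Rightarrow> bool list" where
  "make_label v A = encode_nats (v # sorted_list_of_set (encode_edge ` A))"

definition label_vertex :: "bool list \<Rightarrow> nat" where
  "label_vertex l = hd (inv encode_nats l)"

definition label_graph :: "bool list \<Rightarrow> nat set set" where
  "label_graph l = decode_edge ` set (tl (inv encode_nats l))"

lemma label_vertex_make_label: "label_vertex (make_label v A) = v"
  by (simp add: label_vertex_def make_label_def inv_f_f[OF inj_encode_nats])

lemma label_graph_make_label:
  assumes "finite A" "\<And>e. e \<in> A \<Longrightarrow> card e = 2"
  shows "label_graph (make_label v A) = A"
proof -
  have "label_graph (make_label v A) = (\<lambda>e. decode_edge (encode_edge e)) ` A"
    using assms(1)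
    by (simp add: label_graph_def make_label_def inv_f_f[OF inj_encode_nats] image_image)
  also have "\<dots> = (\<lambda>e. e) ` A" using assms(2) decode_encode_edge by (intro image_cong) auto
  finally show ?thesis by simp
qed

lemma length_make_label:
  assumes "finite A" "\<And>e. e \<in> A \<Longrightarrow> card e = 2 \<and> e \<subseteq> {..<2 ^ k}" "v < 2 ^ k"
  shows "length (make_label v A) \<le> (1 + card A) * (4 * k + 5)"
proof -
  let ?ns = "v # sorted_list_of_set (encode_edge ` A)"
  have "v < 2 ^ (2 * k + 2)"
    using assms(3) power_increasing[of k "2 * k + 2" "2 :: nat"] by linarith
  hence "length (make_label v A) \<le> length ?ns * (2 * (2 * k + 2) + 1)"
    unfolding make_label_def using assms encode_edge_less by (intro length_encode_nats) auto
  also have "\<dots> \<le> (1 + card A) * (4 * k + 5)"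
    using assms(1) by (intro mult_mono) (auto simp: card_image_le)
  finally show ?thesis .
qed

section \<open>The universal decoder and the label size\<close>

definition decode_dist :: "bool list \<Rightarrow> bool list \<Rightarrow> nat set set \<Rightarrow> enat" where
  "decode_dist l l' F = graph_dist (label_graph l \<union> label_graph l' - F) (label_vertex l) (label_vertex l')"

text \<open>The first factor bounds how many numbers are stored, the vertex and its edges. With
  \<open>n \<le> 2 ^ k\<close>, each number is below \<open>2 ^ (2 * k + 2)\<close> and takes at
  most \<open>2 * (2 * k + 2) + 1 = 4 * k + 5\<close> bits.\<close>

definition label_size :: "nat \<Rightarrow> nat \<Rightarrow> nat" where
  "label_size f n = (1 + nat \<lfloor>last_edges_const f * n powr (2 - 1 / 2 ^ f)\<rfloor>) * (4 * nat \<lceil>log 2 n\<rceil> + 5)"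

lemma label_size_soft_bigo:
  "(\<lambda>n. real (label_size f n)) \<in> soft_bigo (\<lambda>n. real n powr (2 - 1 / 2 ^ f))"
proof -
  define a :: real where "a = 2 - 1 / 2 ^ f"
  have a: "0 < a"
  proof -
    have "1 / 2 ^ f \<le> (1 :: real)" by simp
    thus ?thesis unfolding a_def by linarith
  qed
  define C where "C = last_edges_const f"
  have C: "1 \<le> C" unfolding C_def by (rule last_edges_const_ge_1)
  have "(\<lambda>n. real (label_size f n)) \<in> O(\<lambda>n. (1 + C * real n powr a) * (4 * (log 2 (real n) + 1) + 5))"
  proof (intro bigoI[of _ 1] eventually_mono[OF eventually_ge_at_top[of 1]])
    fix n :: nat assume n: "1 \<le> n"
    have log: "0 \<le> log 2 (real n)" using n by simp
    have "real (nat \<lfloor>C * real n powr a\<rfloor>) \<le> C * real n powr a"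
      using C by (simp add: of_nat_floor)
    moreover have "real (nat \<lceil>log 2 (real n)\<rceil>) \<le> log 2 (real n) + 1"
      using log by linarith
    ultimately have "(1 + real (nat \<lfloor>C * real n powr a\<rfloor>)) * (4 * real (nat \<lceil>log 2 (real n)\<rceil>) + 5)
        \<le> (1 + C * real n powr a) * (4 * (log 2 (real n) + 1) + 5)"
      using C by (intro mult_mono) simp_all
    hence "real (label_size f n) \<le> (1 + C * real n powr a) * (4 * (log 2 (real n) + 1) + 5)"
      unfolding label_size_def a_def C_def of_nat_mult of_nat_add by (simp only: of_nat_1 of_nat_numeral)
    thus "norm (real (label_size f n)) \<le> 1 * norm ((1 + C * real n powr a) * (4 * (log 2 (real n) + 1) + 5))"
      by simp
  qed
  also have "(\<lambda>n. (1 + C * real n powr a) * (4 * (log 2 (real n) + 1) + 5)) \<in>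
      O(\<lambda>n. real n powr a * ln (real n) ^ 1)"
    using a unfolding log_def by real_asymp
  finally show ?thesis unfolding soft_bigo_def a_def by blast
qed

theorem theorem25:
  fixes f :: nat
  shows "\<exists>(decode :: bool list \<Rightarrow> bool list \<Rightarrow> nat set set \<Rightarrow> enat) (b :: nat \<Rightarrow> nat).
           (\<lambda>n. real (b n)) \<in> soft_bigo (\<lambda>n. real n powr (2 - 1 / 2 ^ f)) \<and>
           (\<forall>(n :: nat) (E :: nat set set). simple_graph {..<n} E \<longrightarrow>
              (\<exists>L :: nat \<Rightarrow> bool list.
                 ft_distance_labeling (f + 1) decode {..<n} E L \<and>
                 (\<forall>v<n. length (L v) \<le> b n)))"
proof (rule exI[of _ decode_dist], rule exI[of _ "label_size f"], intro conjI allI impI)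
  show "(\<lambda>n. real (label_size f n)) \<in> soft_bigo (\<lambda>n. real n powr (2 - 1 / 2 ^ f))"
    by (rule label_size_soft_bigo)
next
  fix n :: nat and E :: "nat set set"
  assume graph: "simple_graph {..<n} E"
  then obtain w M where "tiebreaking {..<n} E w M" using tiebreaking_exists by blast
  then interpret tiebreaking "{..<n}" E w M .
  have "E \<subseteq> Pow {..<n}" using edge_subset by blast
  hence finite: "finite (label_edges f v)" for v
    using label_edges_subset finite_subset by (metis finite_Pow_iff finite_lessThan)
  define L where "L v = make_label v (label_edges f v)" for v
  have graph_L: "label_graph (L v) = label_edges f v" for v
    unfolding L_def using finite edge_card label_edges_subset by (intro label_graph_make_label) blast+
  have "ft_distance_labeling (f + 1) decode_dist {..<n} E L"
    using label_edges_graph_dist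
    by (simp add: ft_distance_labeling_def decode_dist_def graph_L) (simp add: L_def label_vertex_make_label)
  moreover have "length (L v) \<le> label_size f n" if v: "v < n" for v
  proof -
    define k where "k = nat \<lceil>log 2 n\<rceil>"
    have n: "0 < n" using v by simp
    have "real n = 2 powr (log 2 n)" using n by simp
    also have "\<dots> \<le> 2 powr real k" unfolding k_def by (intro powr_mono real_nat_ceiling_ge) simp
    also have "\<dots> = real (2 ^ k)" by (simp add: powr_realpow)
    finally have nk: "n \<le> 2 ^ k" by (simp only: of_nat_le_iff)
    \<comment> \<open>The largest \<open>y\<close> that \<open>card_label_edges\<close> admits, as
      \<open>y ^ 2 ^ f = n\<close>; dividing \<open>n * n\<close> by it gives the exponent
      \<open>2 - 1 / 2 ^ f\<close>.\<close>
    define y where "y = real n powr (1 / 2 ^ f)"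
    have y: "0 < y" using n by (simp add: y_def)
    have "y ^ 2 ^ f = real n"
      using n by (simp add: y_def powr_powr flip: powr_realpow)
    hence "card (label_edges f v) * y \<le> last_edges_const f * n * n"
      using card_label_edges[OF y, of f v] by simp
    hence "card (label_edges f v) \<le> last_edges_const f * n * n / y"
      using y by (simp add: field_simps)
    also have "\<dots> = last_edges_const f * n powr (2 - 1 / 2 ^ f)"
      using n by (simp add: y_def powr_diff power2_eq_square)
    finally have card: "card (label_edges f v) \<le> nat \<lfloor>last_edges_const f * n powr (2 - 1 / 2 ^ f)\<rfloor>"
      by (simp add: le_nat_floor)
    have "length (L v) \<le> (1 + card (label_edges f v)) * (4 * k + 5)"
      unfolding L_def
    proof (rule length_make_label[OF finite])
      show "v < 2 ^ k" using v nk by simp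
      fix e assume "e \<in> label_edges f v"
      hence "e \<in> E" using label_edges_subset by blast
      thus "card e = 2 \<and> e \<subseteq> {..<2 ^ k}" using edge_card edge_subset nk by fastforce
    qed
    also have "\<dots> \<le> label_size f n"
      unfolding label_size_def k_def[symmetric] using card by (intro mult_right_mono add_left_mono) auto
    finally show ?thesis .
  qed
  ultimately show "\<exists>L. ft_distance_labeling (f + 1) decode_dist {..<n} E L \<and>
      (\<forall>v<n. length (L v) \<le> label_size f n)"
    by blast
qed

end
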